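(* Let $n\ge 2$, $N\ge 1$, and let $\mathcal F^*_{(1)^N}$ be the graded tensor product of $N$ copies of the formal evaluation module associated with the fundamental $n$-dimensional representation $\pi$ of $\mathfrak{sl}_n$. Then, as $\mathfrak{sl}_n$-modules and as graded vector spaces, $$\mathcal F^*_{(1)^N}\simeq(\pi^{\otimes N}\otimes R_N)^{S_N},$$ where the superscript denotes the invariants under the diagonal action of $S_N$.
   Context: Let $\pi=\mathbb C^n$ be the fundamental $\mathfrak{sl}_n(\mathbb C)$-module of highest weight $\omega_1$, with standard basis $v_0,\dots,v_{n-1}$, $v_0$ the highest weight vector; $\mathfrak n_-\subset\mathfrak{sl}_n$ is the subalgebra of strictly lower triangular matrices. Graded tensor product of formal evaluation modules. Let $V_N(\mathcal Z)=\pi^{\otimes N}\otimes\mathbb C[z_1,\dots,z_N]$ with $z_i$ formal variables, on which $x\otimes f(t)\in\mathfrak{sl}_n\otimes\mathbb C[t]$ acts as $\sum_{i=1}^N x^{(i)}f(z_i)$, where $x^{(i)}$ is $x$ acting on the $i$-th tensor factor. Let $w_0=(v_0\otimes\cdots\otimes v_0)\otimes 1$ and $\mathcal F_N=U(\mathfrak n_-\otimes\mathbb C[t])w_0$, graded by homogeneous degree in the $z_i$: $\mathcal F_N=\bigoplus_m\mathcal F_N^{(m)}$, and $\mathcal F_N^{(\le m)}=\bigoplus_{m'\le m}\mathcal F_N^{(m')}$. Put $\widetilde{\mathcal F}_N^{(m)}=\big(\mathbb C[z_1,\dots,z_N]\cdot\mathcal F_N^{(\le m-1)}\big)\cap\mathcal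 F_N^{(m)}$ and $\mathcal F^*_{(1)^N}=\bigoplus_{m\ge0}\mathcal F_N^{(m)}/\widetilde{\mathcal F}_N^{(m)}$, with $m$ the grading. The $\mathfrak{sl}_n$-action is the one induced from $V_N(\mathcal Z)$, via the identification of $\mathcal F_N^{(m)}/\widetilde{\mathcal F}_N^{(m)}$ with the degree-$m$ part of $\mathbb C[z_1,\dots,z_N]\cdot\mathcal F_N^{(\le m)}$ modulo the degree-$m$ part of $\mathbb C[z_1,\dots,z_N]\cdot\mathcal F_N^{(\le m-1)}$, both of which are $\mathfrak{sl}_n$-stable. The ring $R_N$. $R_N=\mathbb C[z_1,\dots,z_N]/J_N$, where $J_N$ is the ideal generated by the elementary symmetric polynomials $E_1,\dots,E_N$ in $z_1,\dots,z_N$; it is graded by degree in the $z_i$. $S_N$ acts on $\pi^{\otimes N}$ by permuting tensor factors, on $R_N$ by permuting variables, and diagonally on $\pi^{\otimes N}\otimes R_N$; $\mathfrak{sl}_n$ acts on $\pi^{\otimes N}$ by the coproduct and trivially on $R_N$; the grading on $\pi^{\otimes N}\otimes R_N$ is that of $R_N$. *)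

theory Defs
  imports
    "HOL-Analysis.Analysis"
    "HOL-Library.Poly_Mapping"
    "HOL-Library.Function_Algebras"
    "HOL-Computational_Algebra.Polynomial"
    "HOL-Combinatorics.Perm"
begin

text \<open>
  The ring $C[z_1,\dots,z_N]$, with one variable for each element of the finite type \<open>'v\<close>,
  so that $N$ is \<open>CARD('v)\<close>. A monomial is its exponent vector.
\<close>

type_synonym 'v mpoly = "('v \<Rightarrow>\<^sub>0 nat) \<Rightarrow>\<^sub>0 complex"

definition Const :: "complex \<Rightarrow> 'v mpoly" where
  "Const c = Poly_Mapping.single 0 c"

definition Var :: "'v \<Rightarrow> 'v mpoly" where
  "Var i = Poly_Mapping.single (Poly_Mapping.single i 1) 1"

definition mdeg :: "('v::finite \<Rightarrow>\<^sub>0 nat) \<Rightarrow> nat" where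
  "mdeg \<mu> = (\<Sum>i\<in>UNIV. Poly_Mapping.lookup \<mu> i)"

definition homogeneous :: "nat \<Rightarrow> 'v::finite mpoly \<Rightarrow> bool" where
  "homogeneous m p \<longleftrightarrow> (\<forall>\<mu>\<in>Poly_Mapping.keys p. mdeg \<mu> = m)"

definition subst_vars :: "('v \<Rightarrow> 'v mpoly) \<Rightarrow> 'v::finite mpoly \<Rightarrow> 'v mpoly" where
  "subst_vars f p =
     (\<Sum>\<mu>\<in>Poly_Mapping.keys p.
        Const (Poly_Mapping.lookup p \<mu>) * (\<Prod>i\<in>UNIV. f i ^ Poly_Mapping.lookup \<mu> i))"

text \<open>A permutation \<open>\<sigma>\<close> of the variables sends $z_i$ to $z_{\sigma(i)}$.\<close>

definition perm_mpoly :: "('v \<Rightarrow> 'v) \<Rightarrow> 'v::finite mpoly \<Rightarrow> 'v mpoly" where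
  "perm_mpoly \<sigma> = subst_vars (\<lambda>i. Var (\<sigma> i))"

definition elem_sym :: "nat \<Rightarrow> 'v::finite mpoly" where
  "elem_sym k = (\<Sum>S | card S = k. \<Prod>i\<in>S. Var i)"

lemma module_mult: "module ((*) :: 'a::comm_ring_1 \<Rightarrow> 'a \<Rightarrow> 'a)"
  by unfold_locales (simp_all add: algebra_simps)

definition ideal_generated :: "'a::comm_ring_1 set \<Rightarrow> 'a set" where
  "ideal_generated = module.span (*)"

definition J_ideal :: "'v::finite mpoly set" where
  "J_ideal = ideal_generated (elem_sym ` {1..CARD('v)})"

lemma Const_0 [simp]: "Const 0 = 0"
  and Const_1 [simp]: "Const 1 = 1"
  by (simp_all add: Const_def)

lemma Const_add: "Const (a + b) = Const a + Const b"
  and Const_mult: "Const (a * b) = Const a * Const b"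
  by (simp_all add: Const_def single_add mult_single)

lemma subst_vars_superset:
  assumes "finite A" "Poly_Mapping.keys p \<subseteq> A"
  shows "subst_vars f p =
     (\<Sum>\<mu>\<in>A. Const (Poly_Mapping.lookup p \<mu>) * (\<Prod>i\<in>UNIV. f i ^ Poly_Mapping.lookup \<mu> i))"
  unfolding subst_vars_def
  by (rule sum.mono_neutral_left) (use assms in \<open>auto simp: in_keys_iff\<close>)

lemma subst_vars_add: "subst_vars f (p + q) = subst_vars f p + subst_vars f q"
proof -
  let ?A = "Poly_Mapping.keys p \<union> Poly_Mapping.keys q"
  have "finite ?A" "Poly_Mapping.keys (p + q) \<subseteq> ?A"
    by (simp_all add: keys_add)
  then show ?thesis
    by (simp add: subst_vars_superset[of ?A] lookup_add Const_add distrib_right sum.distrib)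
qed

lemma subst_vars_0 [simp]: "subst_vars f 0 = 0"
  by (simp add: subst_vars_def)

lemma subst_vars_sum: "subst_vars f (sum g A) = (\<Sum>a\<in>A. subst_vars f (g a))"
  by (induction A rule: infinite_finite_induct) (auto simp: subst_vars_add)

lemma subst_vars_single:
  "subst_vars f (Poly_Mapping.single \<mu> c) = Const c * (\<Prod>i\<in>UNIV. f i ^ Poly_Mapping.lookup \<mu> i)"
  by (subst subst_vars_superset[of "{\<mu>}"]) auto

lemma mpoly_expansion:
  "p = (\<Sum>\<mu>\<in>Poly_Mapping.keys p. Poly_Mapping.single \<mu> (Poly_Mapping.lookup p \<mu>))"
  by (rule poly_mapping_eqI)
     (auto simp: lookup_sum lookup_single when_def in_keys_iff)

lemma subst_vars_mult: "subst_vars f (p * q) = subst_vars f p * subst_vars f q"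
proof -
  have single: "subst_vars f (Poly_Mapping.single \<mu> a * Poly_Mapping.single \<nu> b) =
      subst_vars f (Poly_Mapping.single \<mu> a) * subst_vars f (Poly_Mapping.single \<nu> b)"
    for \<mu> \<nu> a b
    by (simp add: mult_single subst_vars_single Const_mult lookup_add power_add prod.distrib)
  have "subst_vars f ((\<Sum>\<mu>\<in>A. Poly_Mapping.single \<mu> (g \<mu>)) * (\<Sum>\<nu>\<in>B. Poly_Mapping.single \<nu> (h \<nu>))) =
      subst_vars f (\<Sum>\<mu>\<in>A. Poly_Mapping.single \<mu> (g \<mu>)) * subst_vars f (\<Sum>\<nu>\<in>B. Poly_Mapping.single \<nu> (h \<nu>))"
    for A B g h
    by (simp add: sum_product subst_vars_sum single)
  from this[where A = "Poly_Mapping.keys p" and B = "Poly_Mapping.keys q" and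
      g = "Poly_Mapping.lookup p" and h = "Poly_Mapping.lookup q"]
  show ?thesis
    by (simp only: mpoly_expansion[symmetric])
qed

lemma subst_vars_1 [simp]: "subst_vars f 1 = 1"
  using subst_vars_single[of f 0 1] by simp

lemma subst_vars_prod: "subst_vars f (prod g A) = (\<Prod>a\<in>A. subst_vars f (g a))"
  by (induction A rule: infinite_finite_induct) (auto simp: subst_vars_mult)

lemma subst_vars_Var: "subst_vars f (Var i) = f i"
proof -
  have "(\<Prod>j\<in>UNIV. f j ^ Poly_Mapping.lookup (Poly_Mapping.single i 1) j) =
      (\<Prod>j\<in>UNIV. if i = j then f j else 1)"
    by (intro prod.cong) (auto simp: lookup_single when_def)
  then show ?thesis
    by (simp add: Var_def subst_vars_single)
qed

lemma perm_elem_sym: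
  assumes "bij \<sigma>"
  shows "perm_mpoly \<sigma> (elem_sym k) = elem_sym k"
proof -
  have inj: "inj_on \<sigma> S" for S
    using assms by (meson bij_is_inj inj_on_subset subset_UNIV)
  have "perm_mpoly \<sigma> (elem_sym k) = (\<Sum>S | card S = k. \<Prod>i\<in>S. Var (\<sigma> i))"
    by (simp add: perm_mpoly_def elem_sym_def subst_vars_sum subst_vars_prod subst_vars_Var)
  also have "\<dots> = (\<Sum>S | card S = k. \<Prod>i\<in>\<sigma> ` S. Var i)"
    by (simp add: prod.reindex[OF inj] o_def)
  also have "\<dots> = elem_sym k"
    unfolding elem_sym_def
  proof (rule sum.reindex_bij_betw[of "image \<sigma>"])
    show "bij_betw ((`) \<sigma>) {S. card S = k} {S. card S = k}"
      by (rule bij_betw_byWitness[where f' = "image (inv \<sigma>)"])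
         (use assms in \<open>auto simp: image_comp bij_is_inj bij_is_surj o_def surj_f_inv_f
            card_image[OF inj] card_image[OF inj_on_subset[OF bij_is_inj[OF bij_imp_bij_inv]]]\<close>)
  qed
  finally show ?thesis .
qed

lemma J_ideal_0: "0 \<in> J_ideal"
  unfolding J_ideal_def ideal_generated_def by (rule module.span_zero[OF module_mult])

lemma J_ideal_add: "p \<in> J_ideal \<Longrightarrow> q \<in> J_ideal \<Longrightarrow> p + q \<in> J_ideal"
  unfolding J_ideal_def ideal_generated_def by (rule module.span_add[OF module_mult])

lemma J_ideal_diff: "p \<in> J_ideal \<Longrightarrow> q \<in> J_ideal \<Longrightarrow> p - q \<in> J_ideal"
  unfolding J_ideal_def ideal_generated_def by (rule module.span_diff[OF module_mult])

lemma J_ideal_uminus: "p \<in> J_ideal \<Longrightarrow> - p \<in> J_ideal"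
  unfolding J_ideal_def ideal_generated_def by (rule module.span_neg[OF module_mult])

lemma J_ideal_mult: "p \<in> J_ideal \<Longrightarrow> r * p \<in> J_ideal"
  unfolding J_ideal_def ideal_generated_def by (rule module.span_scale[OF module_mult])

lemma J_ideal_induct [consumes 1, case_names zero step]:
  assumes "p \<in> J_ideal"
    and "P 0"
    and "\<And>c k q. k \<in> {1..CARD('v::finite)} \<Longrightarrow> P q \<Longrightarrow> P (c * elem_sym k + q)"
  shows "P (p :: 'v mpoly)"
  using assms(1) unfolding J_ideal_def ideal_generated_def
  by (induction rule: module.span_induct_alt[OF module_mult, consumes 1]) (use assms(2,3) in auto)

lemma perm_J_ideal:
  assumes "bij \<sigma>" "p \<in> J_ideal"
  shows "perm_mpoly \<sigma> p \<in> J_ideal"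
  using assms(2)
proof (induction rule: J_ideal_induct)
  case zero
  then show ?case by (simp add: perm_mpoly_def J_ideal_0)
next
  case (step c k q)
  have "elem_sym k \<in> (J_ideal :: 'a mpoly set)"
    unfolding J_ideal_def ideal_generated_def
    using step by (auto intro: module.span_base[OF module_mult])
  moreover have "perm_mpoly \<sigma> (c * elem_sym k + q) = perm_mpoly \<sigma> c * elem_sym k + perm_mpoly \<sigma> q"
    using perm_elem_sym[OF assms(1), of k]
    by (simp add: perm_mpoly_def subst_vars_add subst_vars_mult)
  ultimately show ?case
    using step by (auto intro!: J_ideal_add J_ideal_mult)
qed

lemma lookup_mult_0:
  "Poly_Mapping.lookup (p * q :: 'v::finite mpoly) 0 = Poly_Mapping.lookup p 0 * Poly_Mapping.lookup q 0"
proof -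
  have add0: "\<mu> + \<nu> = 0 \<longleftrightarrow> \<mu> = 0 \<and> \<nu> = 0" for \<mu> \<nu> :: "'v \<Rightarrow>\<^sub>0 nat"
    by (auto simp: poly_mapping_eq_iff lookup_add fun_eq_iff)
  have single: "Poly_Mapping.lookup (Poly_Mapping.single \<mu> a * Poly_Mapping.single \<nu> b) 0 =
      Poly_Mapping.lookup (Poly_Mapping.single \<mu> a) 0 * Poly_Mapping.lookup (Poly_Mapping.single \<nu> b) 0"
    for \<mu> \<nu> :: "'v \<Rightarrow>\<^sub>0 nat" and a b :: complex
    by (simp add: mult_single lookup_single when_def add0)
  have "Poly_Mapping.lookup ((\<Sum>\<mu>\<in>A. Poly_Mapping.single \<mu> (g \<mu>)) * (\<Sum>\<nu>\<in>B. Poly_Mapping.single \<nu> (h \<nu>))) 0 =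
      Poly_Mapping.lookup (\<Sum>\<mu>\<in>A. Poly_Mapping.single \<mu> (g \<mu>)) 0 *
      Poly_Mapping.lookup (\<Sum>\<nu>\<in>B. Poly_Mapping.single \<nu> (h \<nu>)) 0"
    for A B :: "('v \<Rightarrow>\<^sub>0 nat) set" and g h :: "('v \<Rightarrow>\<^sub>0 nat) \<Rightarrow> complex"
    by (simp only: sum_product lookup_sum single)
  from this[where A = "Poly_Mapping.keys p" and B = "Poly_Mapping.keys q" and
      g = "Poly_Mapping.lookup p" and h = "Poly_Mapping.lookup q"]
  show ?thesis
    by (simp only: mpoly_expansion[symmetric])
qed

lemma J_ideal_lookup_0:
  assumes "p \<in> J_ideal"
  shows "Poly_Mapping.lookup p 0 = 0"
  using assms
proof (induction rule: J_ideal_induct)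
  case (step c k q)
  have "Poly_Mapping.single i (1::nat) \<noteq> 0" for i :: 'a
    by (metis lookup_single_eq lookup_zero one_neq_zero)
  then have Var0: "Poly_Mapping.lookup (Var i) 0 = 0" for i :: 'a
    by (simp add: Var_def lookup_single_not_eq)
  have "Poly_Mapping.lookup (\<Prod>i\<in>S. Var i) 0 = 0" if "S \<noteq> {}" for S :: "'a set"
  proof -
    from that obtain i where "i \<in> S" by blast
    then show ?thesis
      by (simp add: prod.remove[of S i] lookup_mult_0 Var0)
  qed
  then have "Poly_Mapping.lookup (elem_sym k :: 'a mpoly) 0 = 0"
    unfolding elem_sym_def lookup_sum
  proof (intro sum.neutral ballI)
    fix S :: "'a set"
    assume "S \<in> {S. card S = k}"
    then have "S \<noteq> {}"
      using step(1) by auto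
    then show "Poly_Mapping.lookup (\<Prod>i\<in>S. Var i) 0 = 0"
      using \<open>\<And>S. S \<noteq> {} \<Longrightarrow> Poly_Mapping.lookup (prod Var S) 0 = 0\<close> by blast
  qed
  then show ?case
    using step by (simp add: lookup_add lookup_mult_0)
qed auto

quotient_type 'v R_ring = "('v::finite \<Rightarrow>\<^sub>0 nat) \<Rightarrow>\<^sub>0 complex" / "\<lambda>p q. p - q \<in> J_ideal"
  morphisms rep_R to_R
proof (rule equivpI)
  show "reflp (\<lambda>p q :: 'v mpoly. p - q \<in> J_ideal)"
    by (auto simp: reflp_def J_ideal_0)
  show "symp (\<lambda>p q :: 'v mpoly. p - q \<in> J_ideal)"
  proof (rule sympI)
    fix p q :: "'v mpoly"
    assume "p - q \<in> J_ideal"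
    then show "q - p \<in> J_ideal"
      using J_ideal_uminus[of "p - q"] by simp
  qed
  show "transp (\<lambda>p q :: 'v mpoly. p - q \<in> J_ideal)"
  proof (rule transpI)
    fix p q r :: "'v mpoly"
    assume "p - q \<in> J_ideal" "q - r \<in> J_ideal"
    then show "p - r \<in> J_ideal"
      using J_ideal_add[of "p - q" "q - r"] by simp
  qed
qed

instantiation R_ring :: (finite) comm_ring_1
begin

lift_definition zero_R_ring :: "'a R_ring" is 0 .

lift_definition one_R_ring :: "'a R_ring" is 1 .

lift_definition plus_R_ring :: "'a R_ring \<Rightarrow> 'a R_ring \<Rightarrow> 'a R_ring" is "(+)"
proof -
  fix a b c d :: "'a mpoly"
  assume "a - b \<in> J_ideal" "c - d \<in> J_ideal"
  then show "a + c - (b + d) \<in> J_ideal"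
    using J_ideal_add[of "a - b" "c - d"] by (simp add: algebra_simps)
qed

lift_definition minus_R_ring :: "'a R_ring \<Rightarrow> 'a R_ring \<Rightarrow> 'a R_ring" is "(-)"
proof -
  fix a b c d :: "'a mpoly"
  assume "a - b \<in> J_ideal" "c - d \<in> J_ideal"
  then show "a - c - (b - d) \<in> J_ideal"
    using J_ideal_diff[of "a - b" "c - d"] by (simp add: algebra_simps)
qed

lift_definition uminus_R_ring :: "'a R_ring \<Rightarrow> 'a R_ring" is uminus
proof -
  fix a b :: "'a mpoly"
  assume "a - b \<in> J_ideal"
  then show "- a - - b \<in> J_ideal"
    using J_ideal_uminus[of "a - b"] by simp
qed

lift_definition times_R_ring :: "'a R_ring \<Rightarrow> 'a R_ring \<Rightarrow> 'a R_ring" is "(*)"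
proof -
  fix a b c d :: "'a mpoly"
  assume "a - b \<in> J_ideal" "c - d \<in> J_ideal"
  then show "a * c - b * d \<in> J_ideal"
    using J_ideal_add[OF J_ideal_mult[of "a - b" c] J_ideal_mult[of "c - d" b]]
    by (simp add: algebra_simps)
qed

instance
proof
  show "(0 :: 'a R_ring) \<noteq> 1"
  proof (transfer, rule notI)
    assume "0 - 1 \<in> (J_ideal :: 'a mpoly set)"
    from J_ideal_lookup_0[OF this] show False
      by (simp add: lookup_minus)
  qed
qed (transfer, simp add: J_ideal_0 algebra_simps)+

end

lift_definition R_const :: "complex \<Rightarrow> 'v::finite R_ring" is Const .

lift_definition perm_R :: "'v::finite perm \<Rightarrow> 'v R_ring \<Rightarrow> 'v R_ring" is perm_mpoly
proof -
  fix \<sigma> :: "'v \<Rightarrow> 'v" and p q :: "'v mpoly"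
  assume "bij \<sigma> \<and> finite {a. \<sigma> a \<noteq> a}" and "p - q \<in> J_ideal"
  then have "perm_mpoly \<sigma> (p - q) \<in> J_ideal"
    by (simp add: perm_J_ideal)
  moreover have "perm_mpoly \<sigma> p = perm_mpoly \<sigma> (p - q) + perm_mpoly \<sigma> q"
    unfolding perm_mpoly_def by (simp flip: subst_vars_add)
  ultimately show "perm_mpoly \<sigma> p - perm_mpoly \<sigma> q \<in> J_ideal"
    by simp
qed

definition R_deg :: "nat \<Rightarrow> 'v::finite R_ring set" where
  "R_deg m = to_R ` {p. homogeneous m p}"

text \<open>
  The basis $v_0,\dots,v_{n-1}$ of $\pi$ is indexed, in this order, by a finite linearly ordered
  type \<open>'n\<close>, so that $n$ is \<open>CARD('n)\<close> and $v_0$ has index \<open>Min UNIV\<close>; the tensor factors of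
  $\pi^{\otimes N}$ are indexed by \<open>'v\<close>, like the variables. For a commutative algebra $A$ over
  the complex numbers, with structure map \<open>\<iota>\<close>, an element of $\pi^{\otimes N}\otimes A$ is given
  by its coordinates: \<open>F w\<close> is the coefficient in $A$ of $\bigotimes_i v_{w(i)}$.
\<close>

type_synonym 'n cmat = "complex^'n^'n"

type_synonym ('n, 'v, 'a) tensor = "('v \<Rightarrow> 'n) \<Rightarrow> 'a"

definition tscale :: "(complex \<Rightarrow> 'a::comm_ring_1) \<Rightarrow> complex \<Rightarrow> ('n, 'v, 'a) tensor \<Rightarrow> ('n, 'v, 'a) tensor"
  where "tscale \<iota> c F = (\<lambda>w. \<iota> c * F w)"

text \<open>$x^{(i)}$, from $x v_k = \sum_j x_{jk} v_j$.\<close>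

definition site_act ::
  "(complex \<Rightarrow> 'a::comm_ring_1) \<Rightarrow> 'n cmat \<Rightarrow> 'v \<Rightarrow> ('n::finite, 'v, 'a) tensor \<Rightarrow> ('n, 'v, 'a) tensor"
  where "site_act \<iota> x i F = (\<lambda>w. \<Sum>k\<in>UNIV. \<iota> (x $ w i $ k) * F (w(i := k)))"

definition diag_act ::
  "(complex \<Rightarrow> 'a::comm_ring_1) \<Rightarrow> 'n cmat \<Rightarrow> ('n::finite, 'v::finite, 'a) tensor \<Rightarrow> ('n, 'v, 'a) tensor"
  where "diag_act \<iota> x F = (\<lambda>w. \<Sum>i\<in>UNIV. site_act \<iota> x i F w)"

definition sl :: "'n::finite cmat set" where
  "sl = {x. trace x = 0}"

definition n_minus :: "'n::{finite,linorder} cmat set" where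
  "n_minus = {x. \<forall>i j. i \<le> j \<longrightarrow> x $ i $ j = 0}"

record ('a, 'n::finite) graded_sl_module =
  gcarrier :: "'a set"
  gadd :: "'a \<Rightarrow> 'a \<Rightarrow> 'a"
  gscale :: "complex \<Rightarrow> 'a \<Rightarrow> 'a"
  gact :: "'n cmat \<Rightarrow> 'a \<Rightarrow> 'a"
  gpart :: "nat \<Rightarrow> 'a set"

definition graded_sl_isomorphic ::
  "('a, 'n::finite) graded_sl_module \<Rightarrow> ('b, 'n) graded_sl_module \<Rightarrow> bool" where
  "graded_sl_isomorphic A B \<longleftrightarrow>
     (\<exists>\<phi>. bij_betw \<phi> (gcarrier A) (gcarrier B) \<and>
          (\<forall>u\<in>gcarrier A. \<forall>v\<in>gcarrier A. \<phi> (gadd A u v) = gadd B (\<phi> u) (\<phi> v)) \<and>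
          (\<forall>c. \<forall>u\<in>gcarrier A. \<phi> (gscale A c u) = gscale B c (\<phi> u)) \<and>
          (\<forall>x\<in>sl. \<forall>u\<in>gcarrier A. \<phi> (gact A x u) = gact B x (\<phi> u)) \<and>
          (\<forall>m. \<phi> ` gpart A m = gpart B m))"

text \<open>\<open>VN\<close> is $V_N(\mathcal Z)$; \<open>current_act x f\<close> is the action of $x\otimes f(t)$, with \<open>f\<close>
  evaluated at each variable $z_i$ by moving its coefficients into the constant polynomials.\<close>

type_synonym ('n, 'v) VN = "('n, 'v, 'v mpoly) tensor"

definition current_act ::
  "'n cmat \<Rightarrow> complex poly \<Rightarrow> ('n::finite, 'v::finite) VN \<Rightarrow> ('n, 'v) VN" where
  "current_act x f F = (\<lambda>w. \<Sum>i\<in>UNIV. poly (map_poly Const f) (Var i) * site_act Const x i F w)"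

definition w0 :: "('n::{finite,linorder}, 'v) VN" where
  "w0 = (\<lambda>w. if w = (\<lambda>_. Min UNIV) then 1 else 0)"

definition VN_deg :: "nat \<Rightarrow> ('n, 'v::finite) VN set" where
  "VN_deg m = {F. \<forall>w. homogeneous m (F w)}"

abbreviation C_span :: "('n, 'v) VN set \<Rightarrow> ('n, 'v) VN set" where
  "C_span \<equiv> module.span (tscale Const)"

text \<open>$C[z_1,\dots,z_N]\cdot S$\<close>

definition Z_span :: "('n, 'v) VN set \<Rightarrow> ('n, 'v) VN set" where
  "Z_span = module.span (\<lambda>p F w. p * F w)"

lemma vector_space_tscale_Const: "vector_space (tscale Const)"
  by unfold_locales (auto simp: tscale_def fun_eq_iff algebra_simps Const_add Const_mult)

lemma module_VN: "module (\<lambda>p (F :: ('n, 'v) VN) w. p * F w)"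
  by unfold_locales (auto simp: fun_eq_iff algebra_simps)

text \<open>$U(\mathfrak n_-\otimes C[t])w_0$ is spanned by the images of $w_0$ under products of
  elements $x\otimes f(t)$.\<close>

definition FN :: "('n::{finite,linorder}, 'v::finite) VN set" where
  "FN = C_span {foldr (\<lambda>(x, f). current_act x f) xs w0 | xs. set xs \<subseteq> n_minus \<times> UNIV}"

definition FN_deg :: "nat \<Rightarrow> ('n::{finite,linorder}, 'v::finite) VN set" where
  "FN_deg m = FN \<inter> VN_deg m"

text \<open>The sum of the parts of degree less than \<open>m\<close>; thus $\mathcal F_N^{(\le m-1)}$ is
  \<open>FN_below m\<close>, also for \<open>m = 0\<close>, and $\mathcal F_N^{(\le m)}$ is \<open>FN_below (Suc m)\<close>.\<close>

definition FN_below :: "nat \<Rightarrow> ('n::{finite,linorder}, 'v::finite) VN set" where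
  "FN_below m = C_span (\<Union>k<m. FN_deg k)"

definition FN_tilde :: "nat \<Rightarrow> ('n::{finite,linorder}, 'v::finite) VN set" where
  "FN_tilde m = Z_span (FN_below m) \<inter> FN_deg m"

text \<open>
  Quotients of subspaces are sets of cosets \<open>v +o W\<close>; cosets of \<open>W\<close> are added as sets. The map
  induced on cosets of \<open>W\<close> by a linear map \<open>h\<close> sends \<open>C\<close> to \<open>h ` C + W\<close>; the summand \<open>W\<close> is needed
  since the image of a coset may be smaller than a coset (for instance when \<open>h\<close> is zero).
\<close>

definition quotient_space :: "'a::plus set \<Rightarrow> 'a set \<Rightarrow> 'a set set" where
  "quotient_space U W = (\<lambda>v. v +o W) ` U"

definition coset_map :: "('a \<Rightarrow> 'a) \<Rightarrow> 'a::plus set \<Rightarrow> 'a set \<Rightarrow> 'a set" where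
  "coset_map h W C = h ` C + W"

definition FN_gr :: "nat \<Rightarrow> ('n::{finite,linorder}, 'v::finite) VN set set" where
  "FN_gr m = quotient_space (FN_deg m) (FN_tilde m)"

text \<open>
  The $sl_n$-action on $\mathcal F_N^{(m)}/\widetilde{\mathcal F}_N^{(m)}$ is transported from
  \<open>quotient_space (ZFN_le m) (ZFN_below m)\<close> along \<open>FN_gr_emb m\<close>, the map induced by the inclusion of
  \<open>FN_deg m\<close> in \<open>ZFN_le m\<close>.
\<close>

definition ZFN_le :: "nat \<Rightarrow> ('n::{finite,linorder}, 'v::finite) VN set" where
  "ZFN_le m = Z_span (FN_below (Suc m)) \<inter> VN_deg m"

definition ZFN_below :: "nat \<Rightarrow> ('n::{finite,linorder}, 'v::finite) VN set" where
  "ZFN_below m = Z_span (FN_below m) \<inter> VN_deg m"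

definition FN_gr_emb :: "nat \<Rightarrow> ('n::{finite,linorder}, 'v::finite) VN set \<Rightarrow> ('n, 'v) VN set" where
  "FN_gr_emb m C = C + ZFN_below m"

definition FN_gr_act ::
  "nat \<Rightarrow> 'n cmat \<Rightarrow> ('n::{finite,linorder}, 'v::finite) VN set \<Rightarrow> ('n, 'v) VN set" where
  "FN_gr_act m x C =
     inv_into (FN_gr m) (FN_gr_emb m) (coset_map (diag_act Const x) (ZFN_below m) (FN_gr_emb m C))"

text \<open>The direct sum of the spaces \<open>FN_gr m\<close>: families of cosets, almost all of them zero.\<close>

definition F_star_carrier :: "(nat \<Rightarrow> ('n::{finite,linorder}, 'v::finite) VN set) set" where
  "F_star_carrier = {c. (\<forall>m. c m \<in> FN_gr m) \<and> finite {m. c m \<noteq> FN_tilde m}}"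

definition F_star :: "(nat \<Rightarrow> ('n::{finite,linorder}, 'v::finite) VN set, 'n) graded_sl_module" where
  "F_star =
     \<lparr> gcarrier = F_star_carrier,
       gadd = (\<lambda>c d m. c m + d m),
       gscale = (\<lambda>a c m. coset_map (tscale Const a) (FN_tilde m) (c m)),
       gact = (\<lambda>x c m. FN_gr_act m x (c m)),
       gpart = (\<lambda>m. {c \<in> F_star_carrier. \<forall>k. k \<noteq> m \<longrightarrow> c k = FN_tilde k}) \<rparr>"

text \<open>Here \<open>\<sigma>\<close> moves the factor at position $i$ to position $\sigma(i)$, hence
  $\bigotimes_i v_{u(i)}$ to $\bigotimes_i v_{u(\sigma^{-1}(i))}$.\<close>

definition diag_perm :: "'v::finite perm \<Rightarrow> ('n, 'v, 'v R_ring) tensor \<Rightarrow> ('n, 'v, 'v R_ring) tensor" where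
  "diag_perm \<sigma> G = (\<lambda>w. perm_R \<sigma> (G (\<lambda>i. w (Perm.apply \<sigma> i))))"

definition R_invariants_carrier :: "('n, 'v::finite, 'v R_ring) tensor set" where
  "R_invariants_carrier = {G. \<forall>\<sigma>. diag_perm \<sigma> G = G}"

definition R_invariants :: "(('n::finite, 'v::finite, 'v R_ring) tensor, 'n) graded_sl_module" where
  "R_invariants =
     \<lparr> gcarrier = R_invariants_carrier,
       gadd = (+),
       gscale = tscale R_const,
       gact = diag_act R_const,
       gpart = (\<lambda>m. {G \<in> R_invariants_carrier. \<forall>w. G w \<in> R_deg m}) \<rparr>"

end

theory Submission
  imports Defs
begin

text \<open>
  Acting on the symmetric vector $w_0$ produces only $S_N$-invariant tensors, and the invariants of
  $V_N(\mathcal Z)$ are generated by $\mathcal F_N$ over the symmetric polynomials: $\mathcal F_N$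
  contains every orbit sum of a monomial tensor whose variables avoid the positions of $v_0$, and
  multiplication by power sums moves the remaining variables away from these positions. As symmetric
  polynomials of positive degree lie in $J_N$, an invariant of degree $m$ is therefore congruent
  modulo $J_N$ to an element of $\mathcal F_N^{(m)}$, and averaging over $S_N$ shows that such an
  element vanishes modulo $J_N$ if and only if it lies in
  $C[z_1,\dots,z_N]\cdot\mathcal F_N^{(\le m-1)}$. So reduction modulo $J_N$, degree by degree,
  is the isomorphism; it is onto since averaging lifts invariants of $\pi^{\otimes N}\otimes R_N$
  to invariants of $V_N(\mathcal Z)$.
\<close>

section \<open>Polynomials\<close>

text \<open>Two different submodules have to agree on invariants of degree m: the multiples of
  elements of lower degree, whose coefficients are arbitrary polynomials, and the tensors with
  coordinates in \<open>J_ideal\<close>. In general neither contains the other; they can be compared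
  only after symmetrization. An arbitrary coefficient in front of an invariant becomes a symmetric
  polynomial of positive degree, hence an element of \<open>J_ideal\<close>. Conversely an
  elementary symmetric factor passes through the symmetrization and leaves an invariant of lower
  degree, which is a combination of elements of \<open>FN\<close>. Since neither span is visibly
  graded, homogeneous components have to be extracted first.

  The second obstacle is that the Lie algebra does not preserve \<open>FN\<close>: a raising
  operator can turn an element of \<open>FN\<close> into a power sum times \<open>w0\<close>. It
  does preserve invariance and degree, so the image is replaced by an element of \<open>FN\<close>
  congruent to it. The congruence has to hold modulo the ideal, for the reduction, and modulo lower
  degree, for the quotient that defines the action; \<open>FN_mod_J\<close> carries both.\<close>

definition zmon :: "('v \<Rightarrow> nat) \<Rightarrow> 'v::finite mpoly" where
  "zmon \<mu> = (\<Prod>i\<in>UNIV. Var i ^ \<mu> i)"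

lemma subst_vars_Const [simp]: "subst_vars f (Const c) = Const c"
  by (simp add: Const_def subst_vars_single)

lemma Var_power: "Var i ^ k = Poly_Mapping.single (Poly_Mapping.single i k) 1"
  by (induction k) (simp_all add: Var_def mult_single flip: single_add)

lemma prod_single_one:
  "(\<Prod>i\<in>A. Poly_Mapping.single (g i) (1::complex)) = Poly_Mapping.single (\<Sum>i\<in>A. g i) 1"
  by (induction A rule: infinite_finite_induct) (simp_all add: mult_single)

lemma poly_mapping_sum_single: "(\<Sum>i\<in>UNIV. Poly_Mapping.single (i::'v::finite) (Poly_Mapping.lookup \<mu> i)) = \<mu>"
  by (rule poly_mapping_eqI) (simp add: lookup_sum lookup_single when_def)

text \<open>The link between the two forms of exponents: \<open>zmon\<close> takes plain functions,
  which can be updated at a point and composed with permutations, while the keys of a polynomial are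
  finitely supported maps.\<close>

lemma zmon_lookup: "zmon (Poly_Mapping.lookup \<mu>) = Poly_Mapping.single \<mu> 1"
  by (simp add: zmon_def Var_power prod_single_one poly_mapping_sum_single)

lemma zmon_single: "zmon \<mu> = Poly_Mapping.single (\<Sum>i\<in>UNIV. Poly_Mapping.single i (\<mu> i)) 1"
  by (simp add: zmon_def Var_power prod_single_one)

lemma single_zmon: "Poly_Mapping.single \<mu> c = Const c * zmon (Poly_Mapping.lookup \<mu>)"
  by (simp add: zmon_lookup Const_def mult_single)

lemma mpoly_induct [case_names zmon add]:
  assumes "\<And>c \<mu>. P (Const c * zmon \<mu>)" and "\<And>p q. P p \<Longrightarrow> P q \<Longrightarrow> P (p + q)"
  shows "P p"
proof -
  have "P (\<Sum>\<mu>\<in>A. Poly_Mapping.single \<mu> (Poly_Mapping.lookup p \<mu>))" if "finite A" for A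
    using that
  proof (induction A)
    case empty
    show ?case using assms(1)[of 0] by simp
  qed (simp add: assms single_zmon)
  from this[of "Poly_Mapping.keys p"] show ?thesis
    by (simp flip: mpoly_expansion)
qed

lemma zmon_0 [simp]: "zmon (\<lambda>_. 0) = 1"
  by (simp add: zmon_def)

lemma zmon_mult: "zmon \<mu> * zmon \<nu> = zmon (\<lambda>i. \<mu> i + \<nu> i)"
  by (simp add: zmon_def power_add prod.distrib)

lemma prod_Var: "(\<Prod>i\<in>S. Var i) = zmon (\<lambda>i. if i \<in> S then 1 else 0)"
proof -
  have "(\<Prod>i\<in>UNIV. Var i ^ (if i \<in> S then 1 else 0)) = (\<Prod>i\<in>UNIV. if i \<in> S then Var i else 1)"
    by (intro prod.cong) auto
  then show ?thesis
    by (simp add: zmon_def flip: prod.inter_restrict)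
qed

lemma Var_power_zmon: "Var i ^ k = zmon (\<lambda>j. if j = i then k else 0)"
proof -
  have "(\<Prod>j\<in>UNIV. Var j ^ (if j = i then k else 0)) = (\<Prod>j\<in>UNIV. if j = i then Var j ^ k else 1)"
    by (intro prod.cong) auto
  then show ?thesis
    by (simp add: zmon_def)
qed

lemma mdeg_sum_single: "mdeg (\<Sum>i\<in>UNIV. Poly_Mapping.single i (\<mu> i)) = (\<Sum>i\<in>UNIV. \<mu> i)"
  by (simp add: mdeg_def lookup_sum lookup_single when_def)

lemma mdeg_add: "mdeg (\<mu> + \<nu>) = mdeg \<mu> + mdeg \<nu>"
  by (simp add: mdeg_def lookup_add sum.distrib)

lemma homogeneous_0 [simp]: "homogeneous m 0"
  by (simp add: homogeneous_def)

lemma homogeneous_add: "homogeneous m p \<Longrightarrow> homogeneous m q \<Longrightarrow> homogeneous m (p + q)"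
  using keys_add[of p q] by (auto simp: homogeneous_def)

lemma homogeneous_sum: "(\<And>a. a \<in> A \<Longrightarrow> homogeneous m (f a)) \<Longrightarrow> homogeneous m (sum f A)"
  by (induction A rule: infinite_finite_induct) (auto intro: homogeneous_add)

lemma homogeneous_mult:
  assumes "homogeneous k p" "homogeneous l q"
  shows "homogeneous (k + l) (p * q)"
proof -
  have "mdeg \<mu> = k + l" if \<mu>: "\<mu> \<in> Poly_Mapping.keys (p * q)" for \<mu>
  proof -
    obtain \<alpha> \<beta> where "\<mu> = \<alpha> + \<beta>" "\<alpha> \<in> Poly_Mapping.keys p" "\<beta> \<in> Poly_Mapping.keys q"
      using \<mu> keys_mult[of p q] by blast
    then show ?thesis
      using assms by (simp add: homogeneous_def mdeg_add)
  qed
  then show ?thesis by (simp add: homogeneous_def)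
qed

lemma homogeneous_Const: "homogeneous 0 (Const c)"
  by (simp add: homogeneous_def Const_def mdeg_def)

lemma homogeneous_Const_mult: "homogeneous m p \<Longrightarrow> homogeneous m (Const c * p)"
  using homogeneous_mult[OF homogeneous_Const] by fastforce

lemma homogeneous_zmon: "homogeneous (\<Sum>i\<in>UNIV. \<mu> i) (zmon \<mu>)"
  by (simp add: homogeneous_def zmon_single mdeg_sum_single)

lemma homogeneous_Var_power: "homogeneous k (Var i ^ k)"
  using homogeneous_zmon[of "\<lambda>j. if j = i then k else 0"] by (simp add: Var_power_zmon)

lemma homogeneous_elem_sym: "homogeneous k (elem_sym k)"
  unfolding elem_sym_def
proof (intro homogeneous_sum)
  fix S :: "'a set" assume "S \<in> {S. card S = k}"
  then show "homogeneous k (prod Var S)"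
    using homogeneous_zmon[of "\<lambda>i. if i \<in> S then 1 else 0"]
    by (simp add: prod_Var sum.If_cases)
qed

section \<open>Homogeneous components of polynomials\<close>

lift_definition hcomp :: "nat \<Rightarrow> 'v::finite mpoly \<Rightarrow> 'v mpoly" is
  "\<lambda>m p \<mu>. if mdeg \<mu> = m then p \<mu> else 0"
  by (rule finite_subset) auto

lemma hcomp_0 [simp]: "hcomp m 0 = 0"
  by (rule poly_mapping_eqI) (simp add: hcomp.rep_eq)

lemma hcomp_add: "hcomp m (p + q) = hcomp m p + hcomp m q"
  by (rule poly_mapping_eqI) (simp add: hcomp.rep_eq lookup_add)

lemma hcomp_diff: "hcomp m (p - q) = hcomp m p - hcomp m q"
  by (rule poly_mapping_eqI) (simp add: hcomp.rep_eq lookup_minus)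

lemma hcomp_sum: "hcomp m (sum f A) = (\<Sum>a\<in>A. hcomp m (f a))"
  by (induction A rule: infinite_finite_induct) (auto simp: hcomp_add)

lemma homogeneous_hcomp: "homogeneous m (hcomp m p)"
  by (auto simp: homogeneous_def in_keys_iff hcomp.rep_eq split: if_splits)

lemma hcomp_homogeneous: "homogeneous k p \<Longrightarrow> hcomp m p = (if m = k then p else 0)"
  by (rule poly_mapping_eqI) (auto simp: hcomp.rep_eq homogeneous_def in_keys_iff)

lemma sum_hcomp:
  assumes "\<And>\<mu>. \<mu> \<in> Poly_Mapping.keys p \<Longrightarrow> mdeg \<mu> < M"
  shows "(\<Sum>m<M. hcomp m p) = p"
proof (rule poly_mapping_eqI)
  fix \<mu>
  have "(\<Sum>m<M. if mdeg \<mu> = m then Poly_Mapping.lookup p \<mu> else 0) = Poly_Mapping.lookup p \<mu>"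
    using assms[of \<mu>] by (auto simp: in_keys_iff)
  then show "Poly_Mapping.lookup (\<Sum>m<M. hcomp m p) \<mu> = Poly_Mapping.lookup p \<mu>"
    by (simp add: lookup_sum hcomp.rep_eq)
qed

lemma hcomp_mult:
  assumes "homogeneous k q"
  shows "hcomp m (p * q) = (if k \<le> m then hcomp (m - k) p * q else 0)"
proof (induction p rule: mpoly_induct)
  case (zmon c \<mu>)
  have p: "homogeneous (sum \<mu> UNIV) (Const c * zmon \<mu>)"
    by (intro homogeneous_Const_mult homogeneous_zmon)
  show ?case
    using hcomp_homogeneous[OF p, of "m - k"] hcomp_homogeneous[OF homogeneous_mult[OF p assms], of m]
    by auto
next
  case (add p q)
  then show ?case by (auto simp: hcomp_add distrib_right)
qed

lemma elem_sym_in_J: "k \<in> {1..CARD('v)} \<Longrightarrow> elem_sym k \<in> (J_ideal :: 'v::finite mpoly set)"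
  unfolding J_ideal_def ideal_generated_def by (auto intro: module.span_base[OF module_mult])

text \<open>The generators are homogeneous, so \<open>c * elem_sym k\<close> contributes either
  \<open>hcomp (m - k) c * elem_sym k\<close> or 0 in degree \<open>m\<close>.\<close>

lemma hcomp_in_J: "p \<in> J_ideal \<Longrightarrow> hcomp m p \<in> J_ideal"
proof (induction rule: J_ideal_induct)
  case zero
  show ?case by (simp add: J_ideal_0)
next
  case (step c k q)
  then show ?case
    by (auto simp: hcomp_add hcomp_mult[OF homogeneous_elem_sym]
        intro!: J_ideal_add J_ideal_mult elem_sym_in_J)
qed

lemma J_ideal_sum: "(\<And>a. a \<in> A \<Longrightarrow> f a \<in> J_ideal) \<Longrightarrow> sum f A \<in> J_ideal"
  by (induction A rule: infinite_finite_induct) (auto intro: J_ideal_add J_ideal_0)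

subsection \<open>Permuting the variables\<close>

lemma perm_mpoly_add: "perm_mpoly \<sigma> (p + q) = perm_mpoly \<sigma> p + perm_mpoly \<sigma> q"
  and perm_mpoly_mult: "perm_mpoly \<sigma> (p * q) = perm_mpoly \<sigma> p * perm_mpoly \<sigma> q"
  and perm_mpoly_sum: "perm_mpoly \<sigma> (sum f A) = (\<Sum>a\<in>A. perm_mpoly \<sigma> (f a))"
  and perm_mpoly_0 [simp]: "perm_mpoly \<sigma> 0 = 0"
  and perm_mpoly_1 [simp]: "perm_mpoly \<sigma> 1 = 1"
  and perm_mpoly_Const [simp]: "perm_mpoly \<sigma> (Const c) = Const c"
  and perm_mpoly_Var [simp]: "perm_mpoly \<sigma> (Var i) = Var (\<sigma> i)"
  and perm_mpoly_prod: "perm_mpoly \<sigma> (prod f A) = (\<Prod>a\<in>A. perm_mpoly \<sigma> (f a))"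
  by (simp_all add: perm_mpoly_def subst_vars_add subst_vars_mult subst_vars_sum subst_vars_Var
      subst_vars_prod)

lemma perm_mpoly_power: "perm_mpoly \<sigma> (p ^ k) = perm_mpoly \<sigma> p ^ k"
  by (induction k) (simp_all add: perm_mpoly_mult)

lemma perm_mpoly_zmon:
  assumes "bij \<sigma>" shows "perm_mpoly \<sigma> (zmon \<mu>) = zmon (\<mu> \<circ> inv \<sigma>)"
proof -
  have "perm_mpoly \<sigma> (zmon \<mu>) = (\<Prod>i\<in>UNIV. Var (\<sigma> i) ^ \<mu> (inv \<sigma> (\<sigma> i)))"
    using assms by (simp add: zmon_def perm_mpoly_prod perm_mpoly_power bij_is_inj)
  also have "\<dots> = (\<Prod>i\<in>UNIV. Var i ^ \<mu> (inv \<sigma> i))"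
    by (rule prod.reindex_bij_betw[OF assms, of "\<lambda>i. Var i ^ \<mu> (inv \<sigma> i)"])
  finally show ?thesis by (simp add: zmon_def)
qed

lemma perm_mpoly_comp: "perm_mpoly \<sigma> (perm_mpoly \<tau> p) = perm_mpoly (\<sigma> \<circ> \<tau>) p"
  by (induction p rule: mpoly_induct)
     (simp_all add: zmon_def perm_mpoly_mult perm_mpoly_prod perm_mpoly_power perm_mpoly_add)

lemma homogeneous_perm:
  assumes "bij \<sigma>" "homogeneous m p"
  shows "homogeneous m (perm_mpoly \<sigma> p)"
proof -
  have "perm_mpoly \<sigma> p = (\<Sum>\<mu>\<in>Poly_Mapping.keys p.
      Const (Poly_Mapping.lookup p \<mu>) * zmon (Poly_Mapping.lookup \<mu> \<circ> inv \<sigma>))"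
    by (subst (1) mpoly_expansion)
       (simp add: single_zmon perm_mpoly_sum perm_mpoly_mult perm_mpoly_zmon[OF assms(1)])
  moreover have "sum (Poly_Mapping.lookup \<mu> \<circ> inv \<sigma>) UNIV = m" if "\<mu> \<in> Poly_Mapping.keys p" for \<mu>
    using that assms(2) sum.reindex_bij_betw[OF bij_imp_bij_inv[OF assms(1)], of "Poly_Mapping.lookup \<mu>"]
    by (simp add: homogeneous_def mdeg_def o_def)
  ultimately show ?thesis
    using homogeneous_zmon by (metis (no_types, lifting) homogeneous_Const_mult homogeneous_sum)
qed

lemma hcomp_perm: "bij \<sigma> \<Longrightarrow> hcomp m (perm_mpoly \<sigma> p) = perm_mpoly \<sigma> (hcomp m p)"
proof (induction p rule: mpoly_induct)
  case (zmon c \<mu>)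
  have p: "homogeneous (sum \<mu> UNIV) (Const c * zmon \<mu>)"
    by (intro homogeneous_Const_mult homogeneous_zmon)
  show ?case
    using hcomp_homogeneous[OF p, of m] hcomp_homogeneous[OF homogeneous_perm[OF zmon p], of m]
    by auto
next
  case (add p q)
  then show ?case by (auto simp: hcomp_add perm_mpoly_add)
qed

text \<open>Translation on the right makes a symmetrization depend only on the orbit of its
  argument; translation on the left, below, makes its value invariant.\<close>

lemma sum_bij_comp_right:
  assumes "bij (\<tau> :: 'v \<Rightarrow> 'v)"
  shows "(\<Sum>\<sigma>|bij \<sigma>. h (\<sigma> \<circ> \<tau>)) = (\<Sum>\<sigma>|bij \<sigma>. h \<sigma>)"
proof (rule sum.reindex_bij_witness[of _ "\<lambda>\<sigma>. \<sigma> \<circ> inv \<tau>" "\<lambda>\<sigma>. \<sigma> \<circ> \<tau>"])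
qed (use assms in \<open>auto simp: o_assoc[symmetric] bij_is_inj surj_iff[THEN iffD1, OF bij_is_surj]
      intro: bij_comp bij_imp_bij_inv\<close>)

lemma sum_bij_comp_left:
  assumes "bij (\<tau> :: 'v \<Rightarrow> 'v)"
  shows "(\<Sum>\<sigma>|bij \<sigma>. h (\<tau> \<circ> \<sigma>)) = (\<Sum>\<sigma>|bij \<sigma>. h \<sigma>)"
proof (rule sum.reindex_bij_witness[of _ "\<lambda>\<sigma>. inv \<tau> \<circ> \<sigma>" "\<lambda>\<sigma>. \<tau> \<circ> \<sigma>"])
qed (use assms in \<open>auto simp: o_assoc bij_is_inj surj_iff[THEN iffD1, OF bij_is_surj]
      intro: bij_comp bij_imp_bij_inv\<close>)

subsection \<open>Symmetric polynomials of positive degree lie in the ideal\<close>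

text \<open>Without the factor 1/N!, which is cancelled only where a conclusion requires it.\<close>

definition psym :: "'v::finite mpoly \<Rightarrow> 'v mpoly" where
  "psym p = (\<Sum>\<sigma>|bij \<sigma>. perm_mpoly \<sigma> p)"

lemma of_nat_mpoly: "of_nat c = (Const (of_nat c) :: 'v mpoly)"
  by (induction c) (simp_all add: Const_add)

lemma Const_inverse_mult: "c \<noteq> 0 \<Longrightarrow> Const (inverse c) * (Const c * p) = p"
  by (simp add: mult.assoc[symmetric] flip: Const_mult)

lemma psym_sum: "psym (sum f A) = (\<Sum>a\<in>A. psym (f a))"
  unfolding psym_def perm_mpoly_sum by (rule sum.swap)

lemma psym_invariant_mult:
  "(\<And>\<sigma>. bij \<sigma> \<Longrightarrow> perm_mpoly \<sigma> q = q) \<Longrightarrow> psym (q * p) = q * psym p"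
  by (simp add: psym_def perm_mpoly_mult sum_distrib_left)

lemma psym_perm: "bij \<sigma> \<Longrightarrow> psym (perm_mpoly \<sigma> p) = psym p"
  using sum_bij_comp_right[of \<sigma> "\<lambda>\<tau>. perm_mpoly \<tau> p"] by (simp add: psym_def perm_mpoly_comp)

text \<open>Swapping \<open>S - T\<close> with \<open>T - S\<close> along a bijection and fixing
  everything else carries \<open>S\<close> to \<open>T\<close>. Being its own inverse, the
  permutation can be applied to exponents without tracking \<open>inv\<close>.\<close>

lemma exchanging_involution:
  fixes S T :: "'v::finite set"
  assumes "card S = card T"
  obtains \<sigma> where "\<And>i. \<sigma> (\<sigma> i) = i" "\<And>i. i \<in> S - T \<Longrightarrow> \<sigma> i \<in> T - S"
    "\<And>i. i \<in> T - S \<Longrightarrow> \<sigma> i \<in> S - T" "\<And>i. i \<in> S \<longleftrightarrow> i \<in> T \<Longrightarrow> \<sigma> i = i"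
proof -
  have "card (S - T) = card (T - S)"
    using assms by (metis card_le_sym_Diff finite nle_le)
  then obtain g where g: "bij_betw g (S - T) (T - S)"
    using finite_same_card_bij[of "S - T" "T - S"] by auto
  define \<sigma> where "\<sigma> i = (if i \<in> S - T then g i else if i \<in> T - S then inv_into (S - T) g i else i)" for i
  have 1: "g i \<in> T - S" "inv_into (S - T) g (g i) = i" if "i \<in> S - T" for i
    using that g by (auto simp: bij_betw_def)
  have 2: "inv_into (S - T) g i \<in> S - T" "g (inv_into (S - T) g i) = i" if "i \<in> T - S" for i
    using that g inv_into_into[of i g "S - T"] f_inv_into_f[of i g "S - T"] by (auto simp: bij_betw_def)
  show ?thesis
    by (rule that[of \<sigma>]) (use 1 2 in \<open>auto simp: \<sigma>_def\<close>)
qed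

text \<open>Multiply the symmetrization of $z^{\mu-1_S}$, where $S$ is the support of \<open>\<mu>\<close>, by the elementary
  symmetric polynomial of degree $|S|$: every monomial that appears is in the orbit of $z^\mu$ or
  has strictly larger support.\<close>

lemma psym_zmon_in_J:
  fixes \<mu> :: "'v::finite \<Rightarrow> nat"
  assumes "\<mu> i \<noteq> 0"
  shows "psym (zmon \<mu>) \<in> J_ideal"
  using assms
\<comment> \<open>Downward induction on the size of the support, which is bounded by the number of
  variables.\<close>
proof (induction "CARD('v) - card {i. \<mu> i \<noteq> 0}" arbitrary: \<mu> i rule: less_induct)
  case less
  define S where "S = {i. \<mu> i \<noteq> 0}"
  define k where "k = card S"
  define \<nu> where "\<nu> i = \<mu> i - 1" for i
  define \<mu>' where "\<mu>' T i = (if i \<in> T then 1 else 0) + \<nu> i" for T i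
  define A where "A = {T. card T = k \<and> {i. \<nu> i \<noteq> 0} \<subseteq> T}"
  define B where "B = {T. card T = k \<and> \<not> {i. \<nu> i \<noteq> 0} \<subseteq> T}"
  have "i \<in> S" using less.prems by (simp add: S_def)
  then have k: "k \<in> {1..CARD('v)}"
    by (auto simp: k_def Suc_le_eq card_gt_0_iff intro: card_mono)
  have "elem_sym k * psym (zmon \<nu>) = psym (elem_sym k * zmon \<nu>)"
    by (simp add: psym_invariant_mult perm_elem_sym)
  also have "\<dots> = (\<Sum>T|card T = k. psym (zmon (\<mu>' T)))"
    by (simp add: elem_sym_def prod_Var sum_distrib_right zmon_mult psym_sum \<mu>'_def[abs_def])
  also have "\<dots> = (\<Sum>T\<in>A. psym (zmon (\<mu>' T))) + (\<Sum>T\<in>B. psym (zmon (\<mu>' T)))"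
    by (subst sum.union_disjoint[symmetric]) (auto simp: A_def B_def intro!: sum.cong)
  \<comment> \<open>As \<open>\<nu>\<close> vanishes outside \<open>T\<close>, the exponent
    \<open>\<mu>\<close> equals 1 on \<open>S - T\<close>; exchanging \<open>S - T\<close> with
    \<open>T - S\<close> therefore turns \<open>\<mu>\<close> into \<open>\<mu>' T\<close>.\<close>
  also have "(\<Sum>T\<in>A. psym (zmon (\<mu>' T))) = (\<Sum>T\<in>A. psym (zmon \<mu>))"
  proof (rule sum.cong[OF refl])
    fix T assume T: "T \<in> A"
    obtain \<sigma> where \<sigma>: "\<And>i. \<sigma> (\<sigma> i) = i" "\<And>i. i \<in> S - T \<Longrightarrow> \<sigma> i \<in> T - S"
      "\<And>i. i \<in> T - S \<Longrightarrow> \<sigma> i \<in> S - T" "\<And>i. i \<in> S \<longleftrightarrow> i \<in> T \<Longrightarrow> \<sigma> i = i"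
      using exchanging_involution[of S T] T by (auto simp: A_def k_def)
    have bij: "bij \<sigma>" by (rule o_bij[of \<sigma>]) (auto simp: \<sigma>(1))
    have inv: "inv \<sigma> = \<sigma>" by (rule inv_equality) (simp_all add: \<sigma>(1))
    have "\<mu> (\<sigma> i) = \<mu>' T i" for i
    proof -
      have \<nu>T: "\<nu> j = 0" if "j \<notin> T" for j using T that by (auto simp: A_def)
      consider "i \<in> S - T" | "i \<in> T - S" | "i \<in> S" "i \<in> T" | "i \<notin> S" "i \<notin> T" by blast
      then show ?thesis
      proof cases
        case 1
        then show ?thesis using \<sigma>(2)[of i] \<nu>T[of i] by (auto simp: S_def \<mu>'_def)
      next
        case 2
        then show ?thesis using \<sigma>(3)[of i] \<nu>T[of "\<sigma> i"] by (auto simp: S_def \<mu>'_def \<nu>_def)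
      qed (auto simp: \<sigma>(4) \<mu>'_def \<nu>_def S_def)
    qed
    then have "zmon (\<mu>' T) = perm_mpoly \<sigma> (zmon \<mu>)"
      by (simp add: perm_mpoly_zmon[OF bij] inv o_def)
    then show "psym (zmon (\<mu>' T)) = psym (zmon \<mu>)"
      by (simp add: psym_perm[OF bij])
  qed
  finally have eq: "of_nat (card A) * psym (zmon \<mu>) =
      elem_sym k * psym (zmon \<nu>) - (\<Sum>T\<in>B. psym (zmon (\<mu>' T)))"
    by simp
  \<comment> \<open>Some \<open>j\<close> outside \<open>T\<close> has
    \<open>\<nu> j \<noteq> 0\<close>, so the support of \<open>\<mu>' T\<close> contains the
    \<open>k + 1\<close> elements of \<open>insert j T\<close>.\<close>
  have "psym (zmon (\<mu>' T)) \<in> J_ideal" if T: "T \<in> B" for T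
  proof -
    obtain j where j: "\<nu> j \<noteq> 0" "j \<notin> T" using T by (auto simp: B_def)
    have "insert j T \<subseteq> {i. \<mu>' T i \<noteq> 0}"
      using j by (auto simp: \<mu>'_def)
    from card_mono[OF _ this] have "k < card {i. \<mu>' T i \<noteq> 0}"
      using T j by (simp add: B_def)
    moreover have "card {i. \<mu>' T i \<noteq> 0} \<le> CARD('v)"
      by (intro card_mono) auto
    ultimately show ?thesis
      using j by (intro less.hyps[of _ j]) (auto simp: k_def S_def \<mu>'_def)
  qed
  then have "Const (of_nat (card A)) * psym (zmon \<mu>) \<in> J_ideal"
    using k elem_sym_in_J[OF k] unfolding of_nat_mpoly[symmetric] eq
    by (intro J_ideal_diff J_ideal_sum) (auto simp: mult.commute[of "elem_sym k"] J_ideal_mult)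
  moreover have "card A \<noteq> 0"
  proof -
    have "S \<in> A" by (auto simp: A_def S_def k_def \<nu>_def)
    then show ?thesis by auto
  qed
  ultimately show ?case
    using J_ideal_mult[of "Const (of_nat (card A)) * psym (zmon \<mu>)" "Const (inverse (of_nat (card A)))"]
    by (simp add: Const_inverse_mult)
qed

lemma psym_in_J:
  assumes "homogeneous m p" "m > 0"
  shows "psym p \<in> J_ideal"
proof -
  have "psym p = (\<Sum>\<mu>\<in>Poly_Mapping.keys p.
      Const (Poly_Mapping.lookup p \<mu>) * psym (zmon (Poly_Mapping.lookup \<mu>)))"
    by (subst mpoly_expansion) (simp add: psym_sum single_zmon psym_invariant_mult)
  also have "\<dots> \<in> J_ideal"
  proof (intro J_ideal_sum J_ideal_mult)
    fix \<mu> assume "\<mu> \<in> Poly_Mapping.keys p"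
    then have "mdeg \<mu> \<noteq> 0" using assms by (auto simp: homogeneous_def)
    then obtain i where "Poly_Mapping.lookup \<mu> i \<noteq> 0" by (auto simp: mdeg_def)
    then show "psym (zmon (Poly_Mapping.lookup \<mu>)) \<in> J_ideal" by (rule psym_zmon_in_J)
  qed
  finally show ?thesis .
qed

text \<open>This is N!; all that the divisions use is that it is nonzero.\<close>

definition bij_count :: "'v::finite itself \<Rightarrow> complex" where
  "bij_count _ = of_nat (card {\<sigma> :: 'v \<Rightarrow> 'v. bij \<sigma>})"

lemma bij_count_nonzero [simp]: "bij_count TYPE('v::finite) \<noteq> 0"
proof -
  have "id \<in> {\<sigma> :: 'v \<Rightarrow> 'v. bij \<sigma>}" by simp
  then show ?thesis by (auto simp: bij_count_def)
qed

definition power_sum :: "nat \<Rightarrow> 'v::finite mpoly" where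
  "power_sum k = (\<Sum>i\<in>UNIV. Var i ^ k)"

lemma perm_power_sum: "bij \<sigma> \<Longrightarrow> perm_mpoly \<sigma> (power_sum k) = power_sum k"
  using sum.reindex_bij_betw[of \<sigma> UNIV UNIV "\<lambda>i. Var i ^ k"]
  by (simp add: power_sum_def perm_mpoly_sum perm_mpoly_power)

lemma psym_invariant:
  assumes "\<And>\<sigma>. bij \<sigma> \<Longrightarrow> perm_mpoly \<sigma> p = p"
  shows "psym p = Const (bij_count TYPE('v)) * (p :: 'v::finite mpoly)"
  using assms by (simp add: psym_def bij_count_def flip: of_nat_mpoly)

text \<open>A symmetric polynomial is 1/N! times its own symmetrization, so \<open>psym_in_J\<close>
  applies to it.\<close>

lemma power_sum_in_J:
  assumes "k > 0" shows "power_sum k \<in> (J_ideal :: 'v::finite mpoly set)"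
proof -
  have "homogeneous k (power_sum k :: 'v mpoly)"
    unfolding power_sum_def by (intro homogeneous_sum homogeneous_Var_power)
  from psym_in_J[OF this assms] have "Const (bij_count TYPE('v)) * power_sum k \<in> (J_ideal :: 'v mpoly set)"
    by (simp add: psym_invariant perm_power_sum)
  from J_ideal_mult[OF this, of "Const (inverse (bij_count TYPE('v)))"] show ?thesis
    by (simp add: Const_inverse_mult)
qed

section \<open>Symmetrization of tensors\<close>

text \<open>The lift of \<open>diag_perm\<close> to polynomial coefficients, with the same
  convention: the factor at \<open>i\<close> moves to \<open>\<sigma> i\<close>, so the coordinate
  at \<open>w\<close> comes from \<open>w \<circ> \<sigma>\<close>.\<close>

definition vperm :: "('v \<Rightarrow> 'v) \<Rightarrow> ('n, 'v::finite) VN \<Rightarrow> ('n, 'v) VN" where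
  "vperm \<sigma> F = (\<lambda>w. perm_mpoly \<sigma> (F (w \<circ> \<sigma>)))"

definition pure_tensor :: "'v mpoly \<Rightarrow> ('v \<Rightarrow> 'n) \<Rightarrow> ('n, 'v) VN" where
  "pure_tensor p w = (\<lambda>u. if u = w then p else 0)"

definition vsym :: "('n, 'v::finite) VN \<Rightarrow> ('n, 'v) VN" where
  "vsym F = (\<Sum>\<sigma>|bij \<sigma>. vperm \<sigma> F)"

definition VS :: "('n, 'v::finite) VN set" where
  "VS = {F. \<forall>\<sigma>. bij \<sigma> \<longrightarrow> vperm \<sigma> F = F}"

text \<open>The kernel of the reduction \<open>toRV\<close>.\<close>

definition VJ :: "('n, 'v::finite) VN set" where
  "VJ = {F. \<forall>w. F w \<in> J_ideal}"

lemma sum_fun_apply: "(\<Sum>a\<in>A. f a) x = (\<Sum>a\<in>A. f a x)"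
  by (induction A rule: infinite_finite_induct) auto

lemma vperm_0 [simp]: "vperm \<sigma> 0 = 0"
  by (simp add: vperm_def fun_eq_iff)

lemma vperm_add: "vperm \<sigma> (F + G) = vperm \<sigma> F + vperm \<sigma> G"
  by (simp add: vperm_def perm_mpoly_add fun_eq_iff)

lemma vperm_sum: "vperm \<sigma> (sum f A) = (\<Sum>a\<in>A. vperm \<sigma> (f a))"
  by (induction A rule: infinite_finite_induct)
     (simp_all only: sum.infinite sum.empty sum.insert vperm_0 vperm_add not_False_eq_True)

lemma vperm_mult: "vperm \<sigma> (\<lambda>w. p * F w) = (\<lambda>w. perm_mpoly \<sigma> p * vperm \<sigma> F w)"
  by (simp add: vperm_def perm_mpoly_mult)

lemma vperm_comp: "vperm \<sigma> (vperm \<tau> F) = vperm (\<sigma> \<circ> \<tau>) F"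
  by (simp add: vperm_def perm_mpoly_comp o_assoc)

lemma vperm_pure:
  assumes "bij \<sigma>" shows "vperm \<sigma> (pure_tensor p w) = pure_tensor (perm_mpoly \<sigma> p) (w \<circ> inv \<sigma>)"
proof -
  have "u \<circ> \<sigma> = w \<longleftrightarrow> u = w \<circ> inv \<sigma>" for u :: "'a \<Rightarrow> 'b"
    using assms by (metis bij_is_inj bij_is_surj comp_assoc comp_id inv_o_cancel surj_iff)
  then show ?thesis
    by (auto simp: vperm_def pure_tensor_def fun_eq_iff[where ?'b = "'a mpoly"])
qed

lemma vsym_add: "vsym (F + G) = vsym F + vsym G"
  by (simp add: vsym_def vperm_add sum.distrib)

lemma vsym_sum: "vsym (sum f A) = (\<Sum>a\<in>A. vsym (f a))"
  unfolding vsym_def vperm_sum by (rule sum.swap)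

lemma vsym_invariant_mult:
  assumes "\<And>\<sigma>. bij \<sigma> \<Longrightarrow> perm_mpoly \<sigma> p = p"
  shows "vsym (\<lambda>w. p * F w) = (\<lambda>w. p * vsym F w)"
  using assms by (simp add: vsym_def vperm_mult fun_eq_iff sum_fun_apply sum_distrib_left)

text \<open>The counterpart of \<open>vsym_invariant_mult\<close>: now the vector is invariant, and
  only the coefficient is symmetrized. This is how the arbitrary coefficients in
  \<open>Z_span\<close> become symmetric polynomials.\<close>

lemma vsym_mult_invariant:
  assumes "F \<in> VS"
  shows "vsym (\<lambda>w. p * F w) = (\<lambda>w. psym p * F w)"
  using assms by (simp add: vsym_def psym_def VS_def vperm_mult fun_eq_iff sum_fun_apply sum_distrib_right)

lemma vsym_vperm: "bij \<sigma> \<Longrightarrow> vsym (vperm \<sigma> F) = vsym F"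
  using sum_bij_comp_right[of \<sigma> "\<lambda>\<tau>. vperm \<tau> F"] by (simp add: vsym_def vperm_comp)

lemma vsym_in_VS: "vsym F \<in> VS"
  using sum_bij_comp_left[of _ "\<lambda>\<tau>. vperm \<tau> F"] by (simp add: VS_def vsym_def vperm_sum vperm_comp)

lemma vsym_VS:
  assumes "(F :: ('n, 'v::finite) VN) \<in> VS"
  shows "vsym F = (\<lambda>w. Const (bij_count TYPE('v)) * F w)"
proof -
  have "vsym F = (\<Sum>\<sigma>|bij (\<sigma> :: 'v \<Rightarrow> 'v). F)"
    unfolding vsym_def using assms by (intro sum.cong) (auto simp: VS_def)
  then show ?thesis
    by (simp only: fun_eq_iff sum_fun_apply) (simp add: bij_count_def flip: of_nat_mpoly)
qed

lemma sum_pure: "(\<Sum>w\<in>UNIV. pure_tensor (F w) w) = (F :: ('n::finite, 'v::finite) VN)"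
  by (rule ext) (simp add: sum_fun_apply pure_tensor_def)

lemma pure_sum: "pure_tensor (sum f A) w = (\<Sum>a\<in>A. pure_tensor (f a) w)"
  by (rule ext) (simp add: sum_fun_apply pure_tensor_def)

lemma pure_add: "pure_tensor (p + q) w = pure_tensor p w + pure_tensor q w"
  by (rule ext) (simp add: pure_tensor_def)

lemma pure_mult: "pure_tensor (p * q) w = (\<lambda>u. p * pure_tensor q w u)"
  by (rule ext) (simp add: pure_tensor_def)

text \<open>Symmetrizing forgets the chosen point of an orbit, and a transposition is its own
  inverse. Both inductions on orbit sums use this to identify terms that differ by moving one
  variable or factor.\<close>

lemma vsym_transpose:
  "vsym (pure_tensor (zmon (\<mu> \<circ> Transposition.transpose i j)) (w \<circ> Transposition.transpose i j)) =
   vsym (pure_tensor (zmon \<mu>) w)"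
  using vsym_vperm[of "Transposition.transpose i j" "pure_tensor (zmon \<mu>) w"]
  by (simp add: vperm_pure perm_mpoly_zmon)

section \<open>Spans and degrees\<close>

lemma tscale_VN: "tscale Const c F = (\<lambda>w. Const c * F w)"
  by (simp add: tscale_def)

lemma module_tscale_Const: "module (tscale Const)"
  by unfold_locales (auto simp: tscale_def fun_eq_iff algebra_simps Const_add Const_mult)

abbreviation C_subspace :: "('n, 'v) VN set \<Rightarrow> bool" where
  "C_subspace \<equiv> module.subspace (tscale Const)"

abbreviation Z_submodule :: "('n, 'v) VN set \<Rightarrow> bool" where
  "Z_submodule \<equiv> module.subspace (\<lambda>p F w. p * F w)"

lemma C_subspaceI:
  "0 \<in> S \<Longrightarrow> (\<And>F G. F \<in> S \<Longrightarrow> G \<in> S \<Longrightarrow> F + G \<in> S) \<Longrightarrow>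
    (\<And>c F. F \<in> S \<Longrightarrow> (\<lambda>w. Const c * F w) \<in> S) \<Longrightarrow> C_subspace S"
  by (rule module.subspaceI[OF module_tscale_Const]) (simp_all only: tscale_VN)

lemma C_subspace_0: "C_subspace S \<Longrightarrow> 0 \<in> S"
  and C_subspace_add: "C_subspace S \<Longrightarrow> F \<in> S \<Longrightarrow> G \<in> S \<Longrightarrow> F + G \<in> S"
  and C_subspace_diff: "C_subspace S \<Longrightarrow> F \<in> S \<Longrightarrow> G \<in> S \<Longrightarrow> F - G \<in> S"
  and C_subspace_sum: "C_subspace S \<Longrightarrow> (\<And>a. a \<in> A \<Longrightarrow> f a \<in> S) \<Longrightarrow> sum f A \<in> S"
  by (fact module.subspace_0[OF module_tscale_Const] module.subspace_add[OF module_tscale_Const]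
      module.subspace_diff[OF module_tscale_Const] module.subspace_sum[OF module_tscale_Const])+

lemma C_subspace_mult: "C_subspace S \<Longrightarrow> F \<in> S \<Longrightarrow> (\<lambda>w. Const c * F w) \<in> S"
  using module.subspace_scale[OF module_tscale_Const, of S F c] by (simp only: tscale_VN)

lemma Z_submoduleI:
  "0 \<in> S \<Longrightarrow> (\<And>F G. F \<in> S \<Longrightarrow> G \<in> S \<Longrightarrow> F + G \<in> S) \<Longrightarrow>
    (\<And>p F. F \<in> S \<Longrightarrow> (\<lambda>w. p * F w) \<in> S) \<Longrightarrow> Z_submodule S"
  by (rule module.subspaceI[OF module_VN])

lemma C_subspace_Z_submodule: "Z_submodule S \<Longrightarrow> C_subspace S"
  by (rule C_subspaceI) (blast intro: module.subspace_0[OF module_VN] module.subspace_add[OF module_VN]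
      module.subspace_scale[OF module_VN])+

lemma C_subspace_C_span: "C_subspace (C_span S)"
  and C_span_superset: "S \<subseteq> C_span S"
  and C_span_minimal: "S \<subseteq> T \<Longrightarrow> C_subspace T \<Longrightarrow> C_span S \<subseteq> T"
  by (fact module.subspace_span[OF module_tscale_Const] module.span_superset[OF module_tscale_Const]
      module.span_minimal[OF module_tscale_Const])+

lemma Z_submodule_Z_span: "Z_submodule (Z_span S)"
  and Z_span_superset: "S \<subseteq> Z_span S"
  and Z_span_minimal: "S \<subseteq> T \<Longrightarrow> Z_submodule T \<Longrightarrow> Z_span S \<subseteq> T"
  unfolding Z_span_def
  by (fact module.subspace_span[OF module_VN] module.span_superset[OF module_VN]
        module.span_minimal[OF module_VN])+

lemma Z_span_mult: "F \<in> Z_span S \<Longrightarrow> (\<lambda>w. p * F w) \<in> Z_span S"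
  by (rule module.subspace_scale[OF module_VN Z_submodule_Z_span])

lemma C_subspace_Z_span: "C_subspace (Z_span S)"
  by (intro C_subspace_Z_submodule Z_submodule_Z_span)

lemma Z_span_C_span: "Z_span (C_span S) = Z_span S"
proof
  show "Z_span (C_span S) \<subseteq> Z_span S"
    by (intro Z_span_minimal C_span_minimal Z_span_superset C_subspace_Z_span Z_submodule_Z_span)
  show "Z_span S \<subseteq> Z_span (C_span S)"
    using C_span_superset Z_span_superset by (intro Z_span_minimal Z_submodule_Z_span) blast
qed

lemma C_subspace_Int: "C_subspace S \<Longrightarrow> C_subspace T \<Longrightarrow> C_subspace (S \<inter> T)"
  by (rule C_subspaceI) (simp_all only: Int_iff C_subspace_0 C_subspace_add C_subspace_mult simp_thms)

lemma C_subspace_VN_deg: "C_subspace (VN_deg m)"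
  by (rule C_subspaceI) (auto simp: VN_deg_def intro: homogeneous_add homogeneous_Const_mult)

lemma Z_submodule_VJ: "Z_submodule VJ"
  by (rule Z_submoduleI) (auto simp: VJ_def intro: J_ideal_0 J_ideal_add J_ideal_mult)

lemma C_subspace_VJ: "C_subspace VJ"
  by (intro C_subspace_Z_submodule Z_submodule_VJ)

lemma C_subspace_VS: "C_subspace (VS :: ('n, 'v::finite) VN set)"
  unfolding VS_def by (rule C_subspaceI) (auto simp only: vperm_add vperm_mult vperm_0 perm_mpoly_Const)

lemma C_subspace_cancel_Const:
  assumes "C_subspace S" "(\<lambda>w. Const c * F w) \<in> S" "c \<noteq> 0"
  shows "F \<in> S"
  using C_subspace_mult[OF assms(1,2), of "inverse c"] assms(3) by (simp add: Const_inverse_mult)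

text \<open>Characteristic zero: the number of terms is invertible. It is applied to sums whose
  terms have been shown to be equal to one orbit sum.\<close>

lemma C_subspace_cancel_sum:
  assumes "C_subspace S" "(\<Sum>a\<in>A. F) \<in> S" "finite A" "A \<noteq> {}"
  shows "F \<in> S"
proof -
  have "(\<Sum>a\<in>A. F) = (\<lambda>w. Const (of_nat (card A)) * F w)"
    unfolding of_nat_mpoly[symmetric] by (rule ext) (simp add: sum_fun_apply)
  then show ?thesis
    using C_subspace_cancel_Const[OF assms(1), of "of_nat (card A)" F] assms by simp
qed

section \<open>Currents\<close>

definition E_matrix :: "'n::finite \<Rightarrow> 'n \<Rightarrow> 'n cmat" where
  "E_matrix a b = (\<chi> i j. if i = a \<and> j = b then 1 else 0)"

lemma E_matrix_n_minus: "b < a \<Longrightarrow> E_matrix a b \<in> n_minus"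
  by (auto simp: n_minus_def E_matrix_def)

lemma site_act_add: "site_act \<iota> x i (F + G) w = site_act \<iota> x i F w + site_act \<iota> x i G w"
  by (simp add: site_act_def distrib_left sum.distrib)

lemma site_act_mult: "site_act \<iota> x i (\<lambda>w. p * F w) w = p * site_act \<iota> x i F w"
  by (simp add: site_act_def sum_distrib_left mult.left_commute)

text \<open>Updating \<open>w \<circ> \<sigma>\<close> at \<open>i\<close> is updating
  \<open>w\<close> at \<open>\<sigma> i\<close>, so permuting factors moves the acting position
  along.\<close>

lemma site_act_vperm:
  assumes "bij \<sigma>"
  shows "perm_mpoly \<sigma> (site_act Const x i F (w \<circ> \<sigma>)) = site_act Const x (\<sigma> i) (vperm \<sigma> F) w"
proof -
  have "(w \<circ> \<sigma>)(i := k) = w(\<sigma> i := k) \<circ> \<sigma>" for k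
    using assms by (auto simp: fun_eq_iff bij_def inj_eq)
  then show ?thesis
    by (simp add: site_act_def vperm_def perm_mpoly_sum perm_mpoly_mult)
qed

lemma current_act_add: "current_act x f (F + G) = current_act x f F + current_act x f G"
  by (rule ext) (simp only: current_act_def site_act_add plus_fun_apply distrib_left sum.distrib)

lemma current_act_mult: "current_act x f (\<lambda>w. p * F w) = (\<lambda>w. p * current_act x f F w)"
  by (rule ext) (simp only: current_act_def site_act_mult sum_distrib_left mult.left_commute)

lemma current_act_0: "current_act x f 0 = 0"
  by (rule ext) (simp add: current_act_def site_act_def)

lemma current_act_sum: "current_act x f (sum g A) = (\<Sum>a\<in>A. current_act x f (g a))"
  by (induction A rule: infinite_finite_induct)
     (simp_all only: sum.infinite sum.empty sum.insert current_act_add current_act_0 not_False_eq_True)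

lemma perm_poly_Var: "perm_mpoly \<sigma> (poly (map_poly Const f) (Var i)) = poly (map_poly Const f) (Var (\<sigma> i))"
  by (simp add: poly_altdef coeff_map_poly perm_mpoly_sum perm_mpoly_mult perm_mpoly_power)

text \<open>A current pairs the factor at \<open>i\<close> with the variable at \<open>i\<close>,
  and \<open>\<sigma>\<close> relabels both, so the sum over positions is merely reindexed.\<close>

lemma current_act_vperm:
  assumes "bij \<sigma>"
  shows "vperm \<sigma> (current_act x f F) = current_act x f (vperm \<sigma> F)"
proof
  fix w
  have "vperm \<sigma> (current_act x f F) w =
      (\<Sum>i\<in>UNIV. poly (map_poly Const f) (Var (\<sigma> i)) * site_act Const x (\<sigma> i) (vperm \<sigma> F) w)"
    by (subst vperm_def) (simp add: current_act_def perm_mpoly_sum perm_mpoly_mult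
        perm_poly_Var site_act_vperm[OF assms])
  also have "\<dots> = current_act x f (vperm \<sigma> F) w"
    unfolding current_act_def
    by (rule sum.reindex_bij_betw[OF assms, of "\<lambda>i. poly (map_poly Const f) (Var i) * site_act Const x i (vperm \<sigma> F) w"])
  finally show "vperm \<sigma> (current_act x f F) w = current_act x f (vperm \<sigma> F) w" .
qed

lemma current_act_vsym: "current_act x f (vsym F) = vsym (current_act x f F)"
  unfolding vsym_def current_act_sum by (intro sum.cong) (auto simp: current_act_vperm)

lemma current_act_E_pure:
  "current_act (E_matrix a b) (monom 1 k) (pure_tensor p w) =
    (\<Sum>i|w i = b. pure_tensor (Var i ^ k * p) (w(i := a)))"
proof
  fix u :: "'a \<Rightarrow> 'b"
  have "site_act Const (E_matrix a b) i (pure_tensor p w) u =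
      (if w i = b \<and> u = w(i := a) then p else 0)" for i
  proof -
    have "site_act Const (E_matrix a b) i (pure_tensor p w) u =
        (\<Sum>l\<in>UNIV. if l = b then if u i = a then pure_tensor p w (u(i := l)) else 0 else 0)"
      unfolding site_act_def by (rule sum.cong) (auto simp: E_matrix_def)
    also have "\<dots> = (if u i = a \<and> u(i := b) = w then p else 0)"
      by (simp add: pure_tensor_def)
    also have "u i = a \<and> u(i := b) = w \<longleftrightarrow> w i = b \<and> u = w(i := a)"
      by (auto simp: fun_eq_iff)
    finally show ?thesis .
  qed
  then have "current_act (E_matrix a b) (monom 1 k) (pure_tensor p w) u =
      (\<Sum>i\<in>UNIV. if w i = b then pure_tensor (Var i ^ k * p) (w(i := a)) u else 0)"
    by (auto simp: current_act_def map_poly_monom poly_monom pure_tensor_def intro!: sum.cong)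
  then show "current_act (E_matrix a b) (monom 1 k) (pure_tensor p w) u =
      (\<Sum>i|w i = b. pure_tensor (Var i ^ k * p) (w(i := a))) u"
    by (simp add: sum_fun_apply sum.If_cases)
qed

lemma C_subspace_FN: "C_subspace FN"
  unfolding FN_def by (rule C_subspace_C_span)

lemma w0_in_FN: "w0 \<in> FN"
proof -
  have "w0 = foldr (\<lambda>(x, f). current_act x f) [] (w0 :: ('n::{finite,linorder}, 'v::finite) VN)"
    by simp
  then show ?thesis
    unfolding FN_def by (intro subsetD[OF C_span_superset] CollectI exI[of _ "[]"]) auto
qed

lemma C_subspace_current_act_vimage:
  assumes "C_subspace S"
  shows "C_subspace {F. current_act x f F \<in> S}"
  by (rule C_subspaceI)
     (use assms in \<open>simp_all only: mem_Collect_eq current_act_add current_act_mult current_act_0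
        C_subspace_0 C_subspace_add C_subspace_mult\<close>)

lemma current_act_FN:
  fixes F :: "('n::{finite,linorder}, 'v::finite) VN"
  assumes "x \<in> n_minus" "F \<in> FN"
  shows "current_act x f F \<in> FN"
proof -
  have "FN \<subseteq> {F :: ('n, 'v) VN. current_act x f F \<in> FN}"
    unfolding FN_def
  proof (rule C_span_minimal[OF _ C_subspace_current_act_vimage[OF C_subspace_C_span]], rule subsetI)
    fix G :: "('n, 'v) VN"
    assume "G \<in> {foldr (\<lambda>(x, f). current_act x f) xs w0 |xs. set xs \<subseteq> n_minus \<times> UNIV}"
    then obtain xs where "G = foldr (\<lambda>(x, f). current_act x f) xs w0" "set xs \<subseteq> n_minus \<times> UNIV"
      by blast
    with assms(1) show "G \<in> {F. current_act x f F \<in>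
        C_span {foldr (\<lambda>(x, f). current_act x f) xs w0 |xs. set xs \<subseteq> n_minus \<times> UNIV}}"
      by (intro CollectI subsetD[OF C_span_superset] exI[of _ "(x, f) # xs"]) auto
  qed
  with assms(2) show ?thesis by blast
qed

lemma FN_subset_VS: "(FN :: ('n::{finite,linorder}, 'v::finite) VN set) \<subseteq> VS"
  unfolding FN_def
proof (rule C_span_minimal[OF _ C_subspace_VS], rule subsetI)
  fix G :: "('n, 'v) VN"
  assume "G \<in> {foldr (\<lambda>(x, f). current_act x f) xs w0 |xs. set xs \<subseteq> n_minus \<times> UNIV}"
  then obtain xs where G: "G = foldr (\<lambda>(x, f). current_act x f) xs w0"
    by blast
  have "w0 \<in> (VS :: ('n, 'v) VN set)"
    unfolding VS_def
  proof (intro CollectI allI impI)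
    fix \<sigma> :: "'v \<Rightarrow> 'v" assume "bij \<sigma>"
    then have "w \<circ> \<sigma> = (\<lambda>_. Min UNIV) \<longleftrightarrow> w = (\<lambda>_. Min UNIV)" for w :: "'v \<Rightarrow> 'n"
      by (metis bij_pointE comp_apply)
    then show "vperm \<sigma> w0 = (w0 :: ('n, 'v) VN)"
      by (auto simp: vperm_def w0_def fun_eq_iff[where ?'b = "'v mpoly"])
  qed
  moreover have "foldr (\<lambda>(x, f). current_act x f) xs F \<in> VS" if "F \<in> VS" for F :: "('n, 'v) VN"
    using that by (induction xs) (auto simp: VS_def current_act_vperm)
  ultimately show "G \<in> VS" unfolding G by blast
qed

text \<open>The current $E_{w(i),0}\otimes t^{\mu_i}$ maps the orbit sum with position $i$ removed to a sum
  over the positions $j$ that carry $v_0$; exchanging $i$ and $j$ shows that all its terms agree.\<close>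

lemma vsym_zmon_in_FN:
  fixes w :: "'v::finite \<Rightarrow> 'n::{finite,linorder}"
  assumes "\<And>i. w i = Min UNIV \<Longrightarrow> \<mu> i = 0"
  shows "vsym (pure_tensor (zmon \<mu>) w) \<in> FN"
  using assms
proof (induction "card {i. w i \<noteq> Min UNIV}" arbitrary: w \<mu>)
  case 0
  then have "w = (\<lambda>_. Min UNIV)" by auto
  moreover from this have "\<mu> = (\<lambda>_. 0)" using 0 by auto
  ultimately have eq: "pure_tensor (zmon \<mu>) w = w0"
    by (simp add: pure_tensor_def w0_def)
  have "w0 \<in> (VS :: ('n, 'v) VN set)" using w0_in_FN FN_subset_VS by blast
  show ?case
    unfolding eq vsym_VS[OF \<open>w0 \<in> VS\<close>] by (intro C_subspace_mult C_subspace_FN w0_in_FN)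
next
  case (Suc n)
  from Suc.hyps(2) have "{i. w i \<noteq> Min UNIV} \<noteq> {}"
    by (metis card.empty nat.distinct(1))
  then obtain i where i: "w i \<noteq> Min UNIV" by blast
  define w' where "w' = w(i := Min UNIV)"
  define \<mu>' where "\<mu>' = \<mu>(i := 0)"
  have "{i. w' i \<noteq> Min UNIV} = {i. w i \<noteq> Min UNIV} - {i}"
    by (auto simp: w'_def)
  then have "card {i. w' i \<noteq> Min UNIV} = n"
    using Suc.hyps(2) i by simp
  then have IH: "vsym (pure_tensor (zmon \<mu>') w') \<in> FN"
    using Suc.prems by (intro Suc.hyps(1)) (auto simp: w'_def \<mu>'_def)
  \<comment> \<open>Every other basis vector is reached from the highest weight vector by a strictly
    lower triangular matrix unit.\<close>
  have "Min UNIV < w i" using i by (simp add: order.not_eq_order_implies_strict)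
  then have "E_matrix (w i) (Min UNIV) \<in> n_minus"
    by (rule E_matrix_n_minus)
  from current_act_FN[OF this IH, of "monom 1 (\<mu> i)"]
  have "(\<Sum>j|w' j = Min UNIV. vsym (pure_tensor (Var j ^ \<mu> i * zmon \<mu>') (w'(j := w i)))) \<in> FN"
    by (simp only: current_act_vsym current_act_E_pure vsym_sum)
  also have "(\<Sum>j|w' j = Min UNIV. vsym (pure_tensor (Var j ^ \<mu> i * zmon \<mu>') (w'(j := w i)))) =
      (\<Sum>j|w' j = Min UNIV. vsym (pure_tensor (zmon \<mu>) w))"
  proof (rule sum.cong[OF refl])
    fix j assume j: "j \<in> {j. w' j = Min UNIV}"
    let ?\<tau> = "Transposition.transpose i j"
    \<comment> \<open>Another position \<open>j\<close> in the sum carries the highest weight vector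
      already in \<open>w\<close>, so the hypothesis gives it exponent 0; moving factor and power
      from \<open>i\<close> to \<open>j\<close> is thus the transposition.\<close>
    have 0: "j = i \<or> \<mu> j = 0 \<and> w j = Min UNIV"
      using j Suc.prems by (auto simp: w'_def split: if_splits)
    then have "Var j ^ \<mu> i * zmon \<mu>' = zmon (\<mu> \<circ> ?\<tau>)"
      unfolding Var_power_zmon zmon_mult
      by (intro arg_cong[of _ _ zmon]) (auto simp: fun_eq_iff \<mu>'_def transpose_def)
    moreover have "w'(j := w i) = w \<circ> ?\<tau>"
      using 0 by (auto simp: fun_eq_iff w'_def transpose_def)
    ultimately show "vsym (pure_tensor (Var j ^ \<mu> i * zmon \<mu>') (w'(j := w i))) = vsym (pure_tensor (zmon \<mu>) w)"
      by (simp only: vsym_transpose)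
  qed
  finally show ?case
    \<comment> \<open>The position \<open>i\<close> itself is in the index set, so there is a
      nonzero number of equal terms.\<close>
    by (rule C_subspace_cancel_sum[OF C_subspace_FN]) (auto simp: w'_def)
qed

section \<open>Invariants and the space of currents\<close>

lemma C_subspace_FN_deg: "C_subspace (FN_deg m)"
  unfolding FN_deg_def by (intro C_subspace_Int C_subspace_FN C_subspace_VN_deg)

lemma FN_deg_subset: "FN_deg m \<subseteq> VS \<inter> VN_deg m"
  unfolding FN_deg_def using FN_subset_VS by blast

text \<open>Gives homogeneous generators of the submodule, on which the degree arguments can be
  carried out.\<close>

lemma Z_span_FN_below: "Z_span (FN_below m) = Z_span (\<Union>k<m. FN_deg k)"
  by (simp add: FN_below_def Z_span_C_span)

lemma FN_deg_below: "k < m \<Longrightarrow> FN_deg k \<subseteq> Z_span (FN_below m)"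
  unfolding Z_span_FN_below by (rule subset_trans[OF _ Z_span_superset]) auto

lemma Z_span_FN_below_mono: "k \<le> m \<Longrightarrow> Z_span (FN_below k) \<subseteq> Z_span (FN_below m)"
  unfolding Z_span_FN_below[of k]
  by (intro Z_span_minimal Z_submodule_Z_span UN_least FN_deg_below) auto

lemma VN_deg_vperm: "bij \<sigma> \<Longrightarrow> F \<in> VN_deg m \<Longrightarrow> vperm \<sigma> F \<in> VN_deg m"
  by (simp add: VN_deg_def vperm_def homogeneous_perm)

lemma VN_deg_vsym: "F \<in> VN_deg m \<Longrightarrow> vsym F \<in> VN_deg m"
  unfolding vsym_def by (intro C_subspace_sum C_subspace_VN_deg) (auto intro: VN_deg_vperm)

lemma VN_deg_pure: "homogeneous m p \<Longrightarrow> pure_tensor p w \<in> VN_deg m"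
  by (simp add: VN_deg_def pure_tensor_def)

text \<open>For invariants of degree \<open>m\<close> the two conditions on \<open>F - G\<close>
  turn out to be equivalent (\<open>VS_in_Z_span_iff\<close>), but that is proved by means of this
  set, so both are carried along. Lower degree makes the induction on orbit sums work; the ideal
  gives the comparison with \<open>R_ring\<close>.\<close>

definition FN_mod_J :: "nat \<Rightarrow> ('n::{finite,linorder}, 'v::finite) VN set" where
  "FN_mod_J m = {F. \<exists>G\<in>FN_deg m. F - G \<in> VJ \<inter> Z_span (FN_below m)}"

lemma C_subspace_FN_mod_J: "C_subspace (FN_mod_J m :: ('n::{finite,linorder}, 'v::finite) VN set)"
proof -
  let ?K = "VJ \<inter> Z_span (FN_below m) :: ('n, 'v) VN set"
  have K: "C_subspace ?K"
    by (intro C_subspace_Int C_subspace_VJ C_subspace_Z_span)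
  show ?thesis
  proof (rule C_subspaceI)
    show "0 \<in> (FN_mod_J m :: ('n, 'v) VN set)"
      unfolding FN_mod_J_def using C_subspace_0[OF C_subspace_FN_deg] C_subspace_0[OF K]
      by (intro CollectI bexI[of _ 0]) (simp_all only: diff_0_right)
  next
    fix F G :: "('n, 'v) VN" assume "F \<in> FN_mod_J m" "G \<in> FN_mod_J m"
    then obtain F' G' where F'G': "F' \<in> FN_deg m" "F - F' \<in> ?K" "G' \<in> FN_deg m" "G - G' \<in> ?K"
      unfolding FN_mod_J_def by blast
    have eq: "F + G - (F' + G') = (F - F') + (G - G')" by (simp only: add_diff_add)
    show "F + G \<in> FN_mod_J m"
      unfolding FN_mod_J_def
      using C_subspace_add[OF C_subspace_FN_deg F'G'(1,3)] C_subspace_add[OF K F'G'(2,4)]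
      by (intro CollectI bexI[of _ "F' + G'"]) (simp_all only: eq)
  next
    fix c and F :: "('n, 'v) VN" assume "F \<in> FN_mod_J m"
    then obtain F' where F': "F' \<in> FN_deg m" "F - F' \<in> ?K"
      unfolding FN_mod_J_def by blast
    have "(\<lambda>w. Const c * F w) - (\<lambda>w. Const c * F' w) = (\<lambda>w. Const c * (F - F') w)"
      by (rule ext) (simp add: right_diff_distrib)
    then show "(\<lambda>w. Const c * F w) \<in> FN_mod_J m"
      unfolding FN_mod_J_def
      using C_subspace_mult[OF C_subspace_FN_deg F'(1)] C_subspace_mult[OF K F'(2)]
      by (intro CollectI bexI[of _ "\<lambda>w. Const c * F' w"]) simp_all
  qed
qed

lemma FN_deg_mod_J: "FN_deg m \<subseteq> FN_mod_J m"
proof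
  fix F assume "F \<in> FN_deg m"
  moreover have "F - F \<in> VJ \<inter> Z_span (FN_below m)"
    using C_subspace_0[OF C_subspace_Int[OF C_subspace_VJ C_subspace_Z_span]] by (simp only: diff_self)
  ultimately show "F \<in> FN_mod_J m"
    unfolding FN_mod_J_def by blast
qed

text \<open>The representative has degree exactly \<open>m\<close>, hence the
  \<open>Suc\<close>.\<close>

lemma FN_mod_J_subset: "FN_mod_J m \<subseteq> Z_span (FN_below (Suc m))"
proof
  fix F assume "F \<in> FN_mod_J m"
  then obtain G where G: "G \<in> FN_deg m" "F - G \<in> Z_span (FN_below m)"
    unfolding FN_mod_J_def by blast
  have "G + (F - G) \<in> Z_span (FN_below (Suc m))"
    using G FN_deg_below[of m "Suc m"] Z_span_FN_below_mono[of m "Suc m"]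
    by (intro C_subspace_add[OF C_subspace_Z_span]) auto
  then show "F \<in> Z_span (FN_below (Suc m))" by simp
qed

text \<open>The induction is on the number of positions that carry the highest weight vector
  together with a nonconstant power of their variable; multiplying by a power sum, which is
  symmetric and lies in the ideal, distributes the power over the other positions.\<close>

lemma vsym_zmon_mod_J:
  fixes w :: "'v::finite \<Rightarrow> 'n::{finite,linorder}"
  assumes "sum \<mu> UNIV = m"
  shows "vsym (pure_tensor (zmon \<mu>) w) \<in> FN_mod_J m"
  using assms
proof (induction "card {i. w i = Min UNIV \<and> \<mu> i > 0}" arbitrary: \<mu> m)
  case 0
  then have "vsym (pure_tensor (zmon \<mu>) w) \<in> FN"
    by (intro vsym_zmon_in_FN) (auto simp: card_eq_0_iff)
  moreover have "vsym (pure_tensor (zmon \<mu>) w) \<in> VN_deg m"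
    using homogeneous_zmon[of \<mu>] 0 by (intro VN_deg_vsym VN_deg_pure) simp
  ultimately show ?case
    using FN_deg_mod_J by (auto simp: FN_deg_def)
next
  case (Suc n)
  let ?O = "\<lambda>\<mu>. vsym (pure_tensor (zmon \<mu>) w)"
  let ?Z = "\<lambda>\<mu>. {i. w i = Min UNIV \<and> \<mu> i > 0}"
  from Suc.hyps(2) have "?Z \<mu> \<noteq> {}"
    by (metis card.empty nat.distinct(1))
  then obtain i where i: "w i = Min UNIV" "\<mu> i > 0" by blast
  define \<mu>' where "\<mu>' = \<mu>(i := 0)"
  define \<nu> where "\<nu> j = \<mu>'(j := \<mu>' j + \<mu> i)" for j
  have m: "m = sum \<mu>' UNIV + \<mu> i"
    using Suc.prems by (simp add: \<mu>'_def sum.remove[of UNIV i])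
  have sum_\<nu>: "sum (\<nu> j) UNIV = m" for j
    by (simp add: m \<nu>_def sum.remove[of UNIV j])
  have card': "n = card (?Z \<mu>')"
  proof -
    have "?Z \<mu>' = ?Z \<mu> - {i}" by (auto simp: \<mu>'_def)
    then show ?thesis using Suc.hyps(2) i by simp
  qed
  have "?O \<mu>' \<in> FN_mod_J (sum \<mu>' UNIV)"
    by (rule Suc.hyps(1)[OF card' refl])
  then have "?O \<mu>' \<in> Z_span (FN_below (Suc (sum \<mu>' UNIV)))"
    using FN_mod_J_subset by blast
  \<comment> \<open>As \<open>\<mu> i > 0\<close>, removing this power lowers the degree
    strictly.\<close>
  then have "?O \<mu>' \<in> Z_span (FN_below m)"
    using Z_span_FN_below_mono[of "Suc (sum \<mu>' UNIV)" m] i m by auto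
  moreover have "(\<lambda>u. power_sum (\<mu> i) * ?O \<mu>' u) \<in> VJ"
    using power_sum_in_J[OF i(2), where ?'v = 'v] by (simp add: VJ_def J_ideal_mult mult.commute[of "power_sum _"])
  \<comment> \<open>The witness is 0: the product lies both in the ideal and among the multiples of
    lower degree.\<close>
  ultimately have P: "(\<lambda>u. power_sum (\<mu> i) * ?O \<mu>' u) \<in> FN_mod_J m"
    unfolding FN_mod_J_def using C_subspace_0[OF C_subspace_FN_deg]
    by (intro CollectI bexI[of _ 0]) (simp_all only: diff_0_right Z_span_mult Int_iff simp_thms)
  have "(\<lambda>u. power_sum (\<mu> i) * ?O \<mu>' u) = (\<Sum>j\<in>UNIV. ?O (\<nu> j))"
  proof -
    have "(\<lambda>u. power_sum (\<mu> i) * ?O \<mu>' u) = vsym (pure_tensor (power_sum (\<mu> i) * zmon \<mu>') w)"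
      by (simp add: pure_mult vsym_invariant_mult perm_power_sum)
    also have "power_sum (\<mu> i) * zmon \<mu>' = (\<Sum>j\<in>UNIV. zmon (\<nu> j))"
      unfolding power_sum_def sum_distrib_right
      by (intro sum.cong refl, unfold Var_power_zmon zmon_mult)
         (auto intro!: arg_cong[of _ _ zmon] simp: \<nu>_def fun_eq_iff)
    finally show ?thesis by (simp only: pure_sum vsym_sum)
  qed
  \<comment> \<open>In the first part the power lands on a position with the highest weight vector
    and exponent 0, as at \<open>i\<close>, which gives the orbit of \<open>\<mu>\<close> again. In
    the second part no new such position becomes occupied, so the count stays that of
    \<open>\<mu>'\<close>, and the induction hypothesis applies.\<close>
  also have "\<dots> = (\<Sum>j\<in>{j. w j = Min UNIV \<and> \<mu>' j = 0}. ?O (\<nu> j)) +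
      (\<Sum>j\<in>- {j. w j = Min UNIV \<and> \<mu>' j = 0}. ?O (\<nu> j))"
    by (subst sum.union_disjoint[symmetric]) (auto simp only: finite Compl_partition Compl_disjoint)
  also have "(\<Sum>j\<in>{j. w j = Min UNIV \<and> \<mu>' j = 0}. ?O (\<nu> j)) =
      (\<Sum>j\<in>{j. w j = Min UNIV \<and> \<mu>' j = 0}. ?O \<mu>)"
  proof (rule sum.cong[OF refl])
    fix j assume j: "j \<in> {j. w j = Min UNIV \<and> \<mu>' j = 0}"
    have "\<nu> j = \<mu> \<circ> Transposition.transpose i j" "w = w \<circ> Transposition.transpose i j"
      using i j by (auto simp: fun_eq_iff Transposition.transpose_def \<nu>_def \<mu>'_def)
    then show "?O (\<nu> j) = ?O \<mu>"
      using vsym_transpose[of \<mu> i j w] by simp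
  qed
  finally have eq: "(\<Sum>j\<in>{j. w j = Min UNIV \<and> \<mu>' j = 0}. ?O \<mu>) =
      (\<lambda>u. power_sum (\<mu> i) * ?O \<mu>' u) - (\<Sum>j\<in>- {j. w j = Min UNIV \<and> \<mu>' j = 0}. ?O (\<nu> j))"
    by (simp only: add_diff_cancel_right')
  have IH: "?O (\<nu> j) \<in> FN_mod_J m" if "j \<in> - {j. w j = Min UNIV \<and> \<mu>' j = 0}" for j
  proof -
    have "?Z (\<nu> j) = ?Z \<mu>'" using that by (auto simp: \<nu>_def)
    then show ?thesis
      using card' sum_\<nu> by (intro Suc.hyps(1)) simp_all
  qed
  have "(\<Sum>j\<in>{j. w j = Min UNIV \<and> \<mu>' j = 0}. ?O \<mu>) \<in> FN_mod_J m"
    unfolding eq by (intro C_subspace_diff C_subspace_sum C_subspace_FN_mod_J P IH)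
  then show ?case
    using i by (rule_tac C_subspace_cancel_sum[OF C_subspace_FN_mod_J]) (auto simp: \<mu>'_def)
qed

text \<open>An invariant is 1/N! times its own symmetrization, hence a combination of orbit sums of
  monomial tensors.\<close>

lemma VS_mod_J:
  assumes "F \<in> VS" "F \<in> VN_deg m"
  shows "F \<in> (FN_mod_J m :: ('n::{finite,linorder}, 'v::finite) VN set)"
proof -
  have "vsym (pure_tensor (F w) w) \<in> FN_mod_J m" for w
  proof -
    have "vsym (pure_tensor (F w) w) = (\<Sum>\<mu>\<in>Poly_Mapping.keys (F w).
        (\<lambda>u. Const (Poly_Mapping.lookup (F w) \<mu>) * vsym (pure_tensor (zmon (Poly_Mapping.lookup \<mu>)) w) u))"
      by (subst mpoly_expansion) (simp add: pure_sum vsym_sum single_zmon pure_mult vsym_invariant_mult)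
    also have "\<dots> \<in> FN_mod_J m"
      using assms(2)
      by (intro C_subspace_sum C_subspace_mult C_subspace_FN_mod_J vsym_zmon_mod_J)
         (auto simp: VN_deg_def homogeneous_def mdeg_def)
    finally show ?thesis .
  qed
  then have "vsym (\<Sum>w\<in>UNIV. pure_tensor (F w) w) \<in> FN_mod_J m"
    unfolding vsym_sum by (intro C_subspace_sum C_subspace_FN_mod_J)
  then have "(\<lambda>w. Const (bij_count TYPE('v)) * F w) \<in> FN_mod_J m"
    by (simp only: sum_pure vsym_VS[OF assms(1)])
  then show ?thesis
    by (rule C_subspace_cancel_Const[OF C_subspace_FN_mod_J]) simp
qed

lemma VS_in_Z_span: "F \<in> VS \<Longrightarrow> F \<in> VN_deg m \<Longrightarrow> m < k \<Longrightarrow> F \<in> Z_span (FN_below k)"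
  using VS_mod_J[of F m] FN_mod_J_subset[of m] Z_span_FN_below_mono[of "Suc m" k] by auto

section \<open>Multiples of lower degree and the ideal, compared on invariants\<close>

definition vhcomp :: "nat \<Rightarrow> ('n, 'v::finite) VN \<Rightarrow> ('n, 'v) VN" where
  "vhcomp m F = (\<lambda>w. hcomp m (F w))"

lemma vhcomp_add: "vhcomp m (F + G) = vhcomp m F + vhcomp m G"
  by (rule ext) (simp add: vhcomp_def hcomp_add)

lemma vhcomp_sum: "vhcomp m (sum f A) = (\<Sum>a\<in>A. vhcomp m (f a))"
  by (rule ext) (simp add: vhcomp_def hcomp_sum sum_fun_apply)

lemma vhcomp_VN_deg: "F \<in> VN_deg m \<Longrightarrow> vhcomp m F = F"
  by (rule ext) (simp add: vhcomp_def VN_deg_def hcomp_homogeneous[of m])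

lemma vhcomp_in_VN_deg: "vhcomp m F \<in> VN_deg m"
  by (simp add: vhcomp_def VN_deg_def homogeneous_hcomp)

lemma vhcomp_in_VS: "F \<in> VS \<Longrightarrow> vhcomp m F \<in> VS"
  by (auto simp: VS_def vhcomp_def vperm_def hcomp_perm[symmetric] fun_eq_iff)

lemma vhcomp_in_VJ: "F \<in> VJ \<Longrightarrow> vhcomp m F \<in> VJ"
  by (simp add: VJ_def vhcomp_def hcomp_in_J)

lemma vhcomp_pure: "vhcomp m (pure_tensor p w) = pure_tensor (hcomp m p) w"
  by (rule ext) (simp add: vhcomp_def pure_tensor_def)

lemma vsym_0 [simp]: "vsym 0 = 0"
  by (simp only: vsym_def vperm_0 sum.neutral_const)

text \<open>For \<open>p\<close> times an invariant of degree \<open>k < m\<close>, the component of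
  degree \<open>m\<close> has coefficient \<open>hcomp (m - k) p\<close>; symmetrizing replaces it
  by a symmetric polynomial of positive degree, which lies in the ideal.\<close>

lemma vsym_vhcomp_in_VJ:
  assumes "(F :: ('n::{finite,linorder}, 'v::finite) VN) \<in> Z_span (FN_below m)"
  shows "vsym (vhcomp m F) \<in> VJ"
proof -
  \<comment> \<open>Quantifying over all multiples makes \<open>T\<close> closed under
    multiplication by polynomials, so that generators suffice.\<close>
  define T :: "('n, 'v) VN set" where "T = {F. \<forall>p. vsym (vhcomp m (\<lambda>w. p * F w)) \<in> VJ}"
  have "Z_submodule T"
  proof (rule Z_submoduleI)
    have "(\<lambda>w. p * (0 :: ('n, 'v) VN) w) = 0" "vhcomp m (0 :: ('n, 'v) VN) = 0" for p
      by (simp_all add: vhcomp_def fun_eq_iff)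
    then show "0 \<in> T"
      by (simp only: T_def mem_Collect_eq vsym_0 C_subspace_0[OF C_subspace_VJ] simp_thms)
  next
    fix F G assume "F \<in> T" "G \<in> T"
    moreover have "(\<lambda>w. p * (F + G) w) = (\<lambda>w. p * F w) + (\<lambda>w. p * G w)" for p
      by (rule ext) (simp add: distrib_left)
    ultimately show "F + G \<in> T"
      by (simp only: T_def mem_Collect_eq vhcomp_add vsym_add C_subspace_add[OF C_subspace_VJ] simp_thms)
  next
    fix p F assume "F \<in> T"
    then have "vsym (vhcomp m (\<lambda>w. (q * p) * F w)) \<in> VJ" for q
      unfolding T_def by blast
    then show "(\<lambda>w. p * F w) \<in> T"
      by (simp add: T_def mult.assoc)
  qed
  moreover have "FN_deg k \<subseteq> T" if "k < m" for k
  proof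
    fix F :: "('n, 'v) VN" assume F: "F \<in> FN_deg k"
    then have deg: "homogeneous k (F w)" for w
      by (simp add: FN_deg_def VN_deg_def)
    have "vsym (vhcomp m (\<lambda>w. p * F w)) = (\<lambda>w. psym (hcomp (m - k) p) * F w)" for p
    proof -
      have "F \<in> VS" using F FN_deg_subset by blast
      from vsym_mult_invariant[OF this] show ?thesis
        using that by (simp add: vhcomp_def hcomp_mult[OF deg])
    qed
    moreover have "psym (hcomp (m - k) p) \<in> J_ideal" for p :: "'v mpoly"
      using that by (intro psym_in_J[OF homogeneous_hcomp]) simp
    ultimately show "F \<in> T"
      by (simp add: T_def VJ_def J_ideal_mult mult.commute[of "psym _"])
  qed
  ultimately have "Z_span (FN_below m) \<subseteq> T"
    unfolding Z_span_FN_below by (intro Z_span_minimal) auto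
  with assms have "vsym (vhcomp m (\<lambda>w. 1 * F w)) \<in> VJ"
    unfolding T_def by blast
  then show ?thesis by simp
qed

text \<open>On a coordinate \<open>c * elem_sym k\<close> the symmetric factor
  \<open>elem_sym k\<close> comes out of the symmetrization. What remains is an invariant of degree
  \<open>m - k\<close>, which is less than \<open>m\<close> as \<open>k\<close> is positive, so
  \<open>VS_in_Z_span\<close> applies.\<close>

lemma vsym_vhcomp_in_Z_span:
  assumes "(F :: ('n::{finite,linorder}, 'v::finite) VN) \<in> VJ"
  shows "vsym (vhcomp m F) \<in> Z_span (FN_below m)"
proof -
  have "vsym (vhcomp m (pure_tensor p w)) \<in> Z_span (FN_below m)" if "p \<in> J_ideal"
    for p and w :: "'v \<Rightarrow> 'n"
    using that
  proof (induction rule: J_ideal_induct)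
    case zero
    have "vhcomp m (pure_tensor 0 w) = 0"
      by (rule ext) (simp add: vhcomp_def pure_tensor_def)
    then show ?case
      by (simp only: vsym_0 C_subspace_0[OF C_subspace_Z_span])
  next
    case (step c k q)
    have "vsym (vhcomp m (pure_tensor (c * elem_sym k) w)) \<in> Z_span (FN_below m)"
    proof (cases "k \<le> m")
      case True
      have "vsym (pure_tensor (hcomp (m - k) c) w) \<in> Z_span (FN_below m)"
        using step(1) True
        by (intro VS_in_Z_span[OF vsym_in_VS VN_deg_vsym[OF VN_deg_pure[OF homogeneous_hcomp]]]) auto
      then have "(\<lambda>u. elem_sym k * vsym (pure_tensor (hcomp (m - k) c) w) u) \<in> Z_span (FN_below m)"
        by (rule Z_span_mult)
      then show ?thesis
        unfolding vhcomp_pure hcomp_mult[OF homogeneous_elem_sym] if_P[OF True]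
        by (simp only: mult.commute[of _ "elem_sym k"] pure_mult vsym_invariant_mult perm_elem_sym)
    next
      case False
      have "pure_tensor 0 w = 0"
        by (rule ext) (simp add: pure_tensor_def)
      with False show ?thesis
        by (simp only: vhcomp_pure hcomp_mult[OF homogeneous_elem_sym] if_False vsym_0
            C_subspace_0[OF C_subspace_Z_span])
    qed
    with step(2) show ?case
      by (simp only: pure_add vhcomp_add vsym_add C_subspace_add[OF C_subspace_Z_span])
  qed
  then have "vsym (vhcomp m (\<Sum>w\<in>UNIV. pure_tensor (F w) w)) \<in> Z_span (FN_below m)"
    unfolding vhcomp_sum vsym_sum using assms
    by (intro C_subspace_sum C_subspace_Z_span) (simp add: VJ_def)
  then show ?thesis by (simp only: sum_pure)
qed

text \<open>On invariants of degree \<open>m\<close>, extracting the component and symmetrizing is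
  multiplication by N!, so the two preceding lemmas speak about \<open>F\<close> itself.\<close>

lemma VS_in_Z_span_iff:
  assumes "(F :: ('n::{finite,linorder}, 'v::finite) VN) \<in> VS" "F \<in> VN_deg m"
  shows "F \<in> Z_span (FN_below m) \<longleftrightarrow> F \<in> VJ"
proof -
  have "vsym (vhcomp m F) = (\<lambda>w. Const (bij_count TYPE('v)) * F w)"
    using assms by (simp only: vhcomp_VN_deg vsym_VS)
  then show ?thesis
    using vsym_vhcomp_in_VJ[of F m] vsym_vhcomp_in_Z_span[of F m]
      C_subspace_cancel_Const[OF C_subspace_VJ, of "bij_count TYPE('v)" F]
      C_subspace_cancel_Const[OF C_subspace_Z_span, of "bij_count TYPE('v)" F]
    by auto
qed

text \<open>Identifies the subspace divided out with the kernel of the reduction on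
  \<open>FN_deg m\<close>; injectivity rests on this.\<close>

lemma FN_tilde_eq: "FN_tilde m = FN_deg m \<inter> VJ"
  using FN_deg_subset VS_in_Z_span_iff unfolding FN_tilde_def by blast

section \<open>The Lie algebra action on invariants and on lower-degree multiples\<close>

lemma diag_act_current: "diag_act Const x F = current_act x 1 F"
  by (simp add: diag_act_def current_act_def)

lemma diag_act_in_VS: "F \<in> VS \<Longrightarrow> diag_act Const x F \<in> VS"
  by (simp add: VS_def diag_act_current current_act_vperm)

lemma diag_act_in_VN_deg: "F \<in> VN_deg m \<Longrightarrow> diag_act Const x F \<in> VN_deg m"
  by (simp add: VN_deg_def diag_act_def site_act_def homogeneous_sum homogeneous_Const_mult)

text \<open>The image of an element of \<open>FN_deg k\<close> may leave \<open>FN\<close>, but it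
  is still an invariant of degree \<open>k < m\<close>, and all of these lie in the span.\<close>

lemma diag_act_in_Z_span:
  assumes "(F :: ('n::{finite,linorder}, 'v::finite) VN) \<in> Z_span (FN_below m)"
  shows "diag_act Const x F \<in> Z_span (FN_below m)"
proof -
  have "Z_submodule {F :: ('n, 'v) VN. current_act x 1 F \<in> Z_span (FN_below m)}"
    by (rule Z_submoduleI) (simp_all only: mem_Collect_eq current_act_add current_act_mult
        current_act_0 Z_span_mult C_subspace_0[OF C_subspace_Z_span] C_subspace_add[OF C_subspace_Z_span])
  moreover have "FN_deg k \<subseteq> {F :: ('n, 'v) VN. current_act x 1 F \<in> Z_span (FN_below m)}" if "k < m" for k
    using that FN_deg_subset[of k] unfolding diag_act_current[symmetric]
    by (auto intro!: VS_in_Z_span diag_act_in_VS diag_act_in_VN_deg)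
  ultimately have "Z_span (FN_below m) \<subseteq> {F :: ('n, 'v) VN. current_act x 1 F \<in> Z_span (FN_below m)}"
    unfolding Z_span_FN_below[of m] by (intro Z_span_minimal) auto
  with assms show ?thesis by (auto simp: diag_act_current)
qed

section \<open>Reduction modulo the ideal\<close>

definition toRV :: "('n, 'v::finite) VN \<Rightarrow> ('n, 'v, 'v R_ring) tensor" where
  "toRV F = (\<lambda>w. to_R (F w))"

lemma to_R_add: "to_R (p + q) = to_R p + to_R q"
  and to_R_mult: "to_R (p * q) = to_R p * to_R q"
  and to_R_Const: "to_R (Const c) = R_const c"
  and to_R_0 [simp]: "to_R 0 = 0"
  by (simp_all add: plus_R_ring.abs_eq times_R_ring.abs_eq R_const.abs_eq zero_R_ring_def)

lemma to_R_sum: "to_R (sum f A) = (\<Sum>a\<in>A. to_R (f a))"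
  by (induction A rule: infinite_finite_induct) (simp_all add: to_R_add)

lemma toRV_eq_iff: "toRV F = toRV G \<longleftrightarrow> F - G \<in> VJ"
  by (simp add: toRV_def VJ_def fun_eq_iff R_ring.abs_eq_iff)

lemma toRV_0 [simp]: "toRV 0 = 0"
  by (simp add: toRV_def fun_eq_iff)

lemma toRV_eq_0_iff: "toRV F = 0 \<longleftrightarrow> F \<in> VJ"
  using toRV_eq_iff[of F 0] by (simp only: diff_0_right toRV_0)

lemma toRV_add: "toRV (F + G) = toRV F + toRV G"
  by (simp add: toRV_def to_R_add fun_eq_iff)

lemma toRV_sum: "toRV (sum f A) = (\<Sum>a\<in>A. toRV (f a))"
  by (simp add: toRV_def to_R_sum fun_eq_iff sum_fun_apply)

lemma toRV_tscale: "toRV (tscale Const c F) = tscale R_const c (toRV F)"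
  by (simp add: toRV_def tscale_def to_R_mult to_R_Const)

lemma toRV_diag_act: "toRV (diag_act Const x F) = diag_act R_const x (toRV F)"
  by (simp add: toRV_def diag_act_def site_act_def to_R_sum to_R_mult to_R_Const)

lemma toRV_vperm: "toRV (vperm (Perm.apply \<sigma>) F) = diag_perm \<sigma> (toRV F)"
proof -
  have "perm_R \<sigma> (to_R p) = to_R (perm_mpoly (Perm.apply \<sigma>) p)" for p
    using perm_R.abs_eq[of "Perm.apply \<sigma>" p]
    by (simp add: eq_onp_def Perm.perm.apply_inverse bij_apply)
  then show ?thesis
    by (simp add: toRV_def vperm_def diag_perm_def o_def)
qed

lemma toRV_in_invariants: "F \<in> VS \<Longrightarrow> toRV F \<in> R_invariants_carrier"
  by (simp add: R_invariants_carrier_def VS_def bij_apply flip: toRV_vperm)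

text \<open>Each permutation changes \<open>F\<^sub>0\<close> only by an element of
  \<open>VJ\<close>, so the average over the group is congruent to \<open>F\<^sub>0\<close>. The
  degree clause is conditional because the lemma serves homogeneous and arbitrary lifts.\<close>

lemma invariant_lift:
  fixes F\<^sub>0 :: "('n, 'v::finite) VN"
  assumes "toRV F\<^sub>0 \<in> R_invariants_carrier"
  obtains F where "F \<in> VS" "toRV F = toRV F\<^sub>0" "\<And>m. F\<^sub>0 \<in> VN_deg m \<Longrightarrow> F \<in> VN_deg m"
proof -
  define F where "F = (\<lambda>w. Const (inverse (bij_count TYPE('v))) * vsym F\<^sub>0 w)"
  have 1: "F \<in> VS"
    unfolding F_def by (intro C_subspace_mult C_subspace_VS vsym_in_VS)
  have 3: "F \<in> VN_deg m" if "F\<^sub>0 \<in> VN_deg m" for m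
    unfolding F_def by (intro C_subspace_mult C_subspace_VN_deg VN_deg_vsym that)
  have "vperm \<sigma> F\<^sub>0 - F\<^sub>0 \<in> VJ" if "bij \<sigma>" for \<sigma>
  proof -
    have "Perm.apply (Perm \<sigma>) = \<sigma>"
      using that by (simp add: Perm.perm.Perm_inverse)
    moreover have "diag_perm (Perm \<sigma>) (toRV F\<^sub>0) = toRV F\<^sub>0"
      using assms by (simp add: R_invariants_carrier_def)
    ultimately show ?thesis
      using toRV_vperm[of "Perm \<sigma>" F\<^sub>0] by (simp add: toRV_eq_iff)
  qed
  then have "(\<Sum>\<sigma>|bij \<sigma>. vperm \<sigma> F\<^sub>0 - F\<^sub>0) \<in> VJ"
    by (intro C_subspace_sum C_subspace_VJ) simp
  also have "(\<Sum>\<sigma>|bij \<sigma>. vperm \<sigma> F\<^sub>0 - F\<^sub>0) = (\<lambda>w. Const (bij_count TYPE('v)) * (F - F\<^sub>0) w)"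
  proof
    fix w
    have "Const (bij_count TYPE('v)) * F w = vsym F\<^sub>0 w"
      using Const_inverse_mult[of "inverse (bij_count TYPE('v))" "vsym F\<^sub>0 w"] by (simp add: F_def)
    then have "Const (bij_count TYPE('v)) * (F - F\<^sub>0) w = vsym F\<^sub>0 w - Const (bij_count TYPE('v)) * F\<^sub>0 w"
      by (simp add: right_diff_distrib)
    then show "(\<Sum>\<sigma>|bij \<sigma>. vperm \<sigma> F\<^sub>0 - F\<^sub>0) w = Const (bij_count TYPE('v)) * (F - F\<^sub>0) w"
      by (simp add: sum_fun_apply sum_subtractf vsym_def bij_count_def flip: of_nat_mpoly)
  qed
  finally have "F - F\<^sub>0 \<in> VJ"
    by (rule C_subspace_cancel_Const[OF C_subspace_VJ]) simp
  with 1 3 show ?thesis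
    by (intro that[of F]) (simp_all only: toRV_eq_iff)
qed

section \<open>Cosets\<close>

lemma coset_eq_iff:
  assumes "C_subspace W"
  shows "F +o W = G +o W \<longleftrightarrow> F - G \<in> W"
proof
  assume "F +o W = G +o W"
  moreover have "F \<in> F +o W"
    using C_subspace_0[OF assms] by (metis add.right_neutral set_plus_intro2)
  ultimately show "F - G \<in> W"
    by (simp only: set_minus_plus)
next
  assume *: "F - G \<in> W"
  have "F +o W = G +o ((F - G) +o W)"
    by (simp only: set_plus_rearrange2 add_diff_cancel_left' add.commute[of G] diff_add_cancel)
  also have "(F - G) +o W = W"
  proof
    show "(F - G) +o W \<subseteq> W"
      using * C_subspace_add[OF assms] by (auto simp only: elt_set_plus_def)
    show "W \<subseteq> (F - G) +o W"
      using * C_subspace_diff[OF assms] by (metis set_minus_plus subsetI)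
  qed
  finally show "F +o W = G +o W" .
qed

lemma coset_plus_subspace:
  assumes "C_subspace W" "U \<subseteq> W" "0 \<in> U"
  shows "(F +o U) + W = F +o W"
proof -
  have "U + W = W"
  proof
    show "U + W \<subseteq> W"
      using assms(2) C_subspace_add[OF assms(1)] by (auto simp only: set_plus_def)
    show "W \<subseteq> U + W"
      using assms(3) by (rule set_zero_plus2)
  qed
  then show ?thesis by (simp only: set_plus_rearrange3)
qed

lemma coset_plus_coset:
  assumes "C_subspace W"
  shows "(F +o W) + (G +o W) = (F + G) +o W"
  unfolding set_plus_rearrange
  using coset_plus_subspace[OF assms order_refl C_subspace_0[OF assms], of "F + G"]
  by (simp only: set_plus_rearrange3)

lemma coset_map_coset:
  fixes W :: "('n, 'v) VN set"
  assumes "C_subspace W" "\<And>F G. h (F + G) = h F + h G" "h ` W \<subseteq> W"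
  shows "coset_map h W (F +o W) = h F +o W"
proof -
  have "h 0 = 0"
    using assms(2)[of 0 0] by (simp only: add_0_left add_cancel_right_right)
  then have "0 \<in> h ` W"
    using C_subspace_0[OF assms(1)] by (metis imageI)
  moreover have "h ` (F +o W) = h F +o (h ` W)"
  proof -
    have *: "G +o U = (+) G ` U" for G and U :: "('n, 'v) VN set"
      by (auto simp only: elt_set_plus_def)
    show ?thesis by (simp only: * image_image assms(2))
  qed
  ultimately show ?thesis
    unfolding coset_map_def using coset_plus_subspace[OF assms(1,3)] by simp
qed

lemma C_subspace_FN_tilde: "C_subspace (FN_tilde m)"
  unfolding FN_tilde_def by (intro C_subspace_Int C_subspace_Z_span C_subspace_FN_deg)

lemma C_subspace_ZFN_below: "C_subspace (ZFN_below m)"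
  unfolding ZFN_below_def by (intro C_subspace_Int C_subspace_Z_span C_subspace_VN_deg)

lemma FN_gr_emb_coset: "FN_gr_emb m (F +o FN_tilde m) = F +o ZFN_below m"
  unfolding FN_gr_emb_def
proof (rule coset_plus_subspace[OF C_subspace_ZFN_below])
  show "FN_tilde m \<subseteq> ZFN_below m"
    by (auto simp: FN_tilde_def ZFN_below_def FN_deg_def)
qed (rule C_subspace_0[OF C_subspace_FN_tilde])

text \<open>\<open>ZFN_below m\<close> meets \<open>FN_deg m\<close> in \<open>FN_tilde m\<close>.
  Injectivity is what lets the \<open>inv_into\<close> in \<open>FN_gr_act\<close> be
  evaluated.\<close>

lemma inj_on_FN_gr_emb: "inj_on (FN_gr_emb m) (FN_gr m)"
proof (rule inj_onI)
  fix C D assume C: "C \<in> FN_gr m" and D: "D \<in> FN_gr m" and eq: "FN_gr_emb m C = FN_gr_emb m D"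
  from C D obtain F G where FG: "F \<in> FN_deg m" "G \<in> FN_deg m" "C = F +o FN_tilde m" "D = G +o FN_tilde m"
    unfolding FN_gr_def quotient_space_def by blast
  have "F - G \<in> ZFN_below m"
    using eq unfolding FG FN_gr_emb_coset coset_eq_iff[OF C_subspace_ZFN_below] .
  moreover have "F - G \<in> FN_deg m"
    using FG by (intro C_subspace_diff C_subspace_FN_deg)
  ultimately have "F - G \<in> FN_tilde m"
    unfolding FN_tilde_def ZFN_below_def by blast
  then show "C = D"
    unfolding FG coset_eq_iff[OF C_subspace_FN_tilde] .
qed

text \<open>The transformed vector is an invariant of degree \<open>m\<close>, and
  \<open>VS_mod_J\<close> supplies a replacement \<open>G\<close> in \<open>FN_deg m\<close>.
  Congruence modulo lower degree identifies the coset, congruence modulo the ideal identifies the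
  reduction.\<close>

lemma FN_gr_act_coset:
  fixes F :: "('n::{finite,linorder}, 'v::finite) VN"
  assumes "F \<in> FN_deg m"
  obtains G where "G \<in> FN_deg m" "FN_gr_act m x (F +o FN_tilde m) = G +o FN_tilde m"
    "toRV G = diag_act R_const x (toRV F)"
proof -
  have F: "F \<in> VS" "F \<in> VN_deg m"
    using assms FN_deg_subset by blast+
  then have xF: "diag_act Const x F \<in> VS" "diag_act Const x F \<in> VN_deg m"
    by (simp_all only: diag_act_in_VS diag_act_in_VN_deg)
  from VS_mod_J[OF xF] obtain G where G: "G \<in> FN_deg m"
    "diag_act Const x F - G \<in> VJ" "diag_act Const x F - G \<in> Z_span (FN_below m)"
    unfolding FN_mod_J_def by blast
  have "G \<in> VN_deg m" using G(1) by (simp add: FN_deg_def)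
  then have below: "diag_act Const x F - G \<in> ZFN_below m"
    unfolding ZFN_below_def using G(3) xF(2) C_subspace_diff[OF C_subspace_VN_deg] by blast
  have "diag_act Const x (F + F') = diag_act Const x F + diag_act Const x F'" for F F' :: "('n, 'v) VN"
    by (simp only: diag_act_current current_act_add)
  moreover have "diag_act Const x ` ZFN_below m \<subseteq> ZFN_below m"
    unfolding ZFN_below_def by (auto intro: diag_act_in_Z_span diag_act_in_VN_deg)
  ultimately have "coset_map (diag_act Const x) (ZFN_below m) (F +o ZFN_below m) =
      diag_act Const x F +o ZFN_below m"
    by (intro coset_map_coset C_subspace_ZFN_below)
  also have "\<dots> = G +o ZFN_below m"
    by (simp only: coset_eq_iff[OF C_subspace_ZFN_below] below)
  also have "\<dots> = FN_gr_emb m (G +o FN_tilde m)"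
    by (simp only: FN_gr_emb_coset)
  finally have "FN_gr_act m x (F +o FN_tilde m) = G +o FN_tilde m"
    unfolding FN_gr_act_def FN_gr_emb_coset[of m F]
    using inv_into_f_f[OF inj_on_FN_gr_emb, of "G +o FN_tilde m" m] G(1)
    by (simp add: FN_gr_def quotient_space_def)
  moreover have "toRV G = diag_act R_const x (toRV F)"
    using G(2) unfolding toRV_diag_act[symmetric] toRV_eq_iff[symmetric] by simp
  ultimately show ?thesis
    using that G(1) by blast
qed

lemma zero_in_FN_deg: "0 \<in> FN_deg m"
  by (rule C_subspace_0[OF C_subspace_FN_deg])

section \<open>Families of homogeneous elements\<close>

text \<open>Representatives of the elements of the direct sum; the finite support makes
  \<open>family_sum\<close> meaningful.\<close>

definition families :: "(nat \<Rightarrow> ('n::{finite,linorder}, 'v::finite) VN) set" where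
  "families = {f. (\<forall>m. f m \<in> FN_deg m) \<and> finite {m. f m \<noteq> 0}}"

definition cosets :: "(nat \<Rightarrow> ('n::{finite,linorder}, 'v::finite) VN) \<Rightarrow> nat \<Rightarrow> ('n, 'v) VN set" where
  "cosets f = (\<lambda>m. f m +o FN_tilde m)"

definition family_sum :: "(nat \<Rightarrow> ('n::{finite,linorder}, 'v::finite) VN) \<Rightarrow> ('n, 'v) VN" where
  "family_sum f = (\<Sum>m|f m \<noteq> 0. f m)"

text \<open>The isomorphism. The choice of representatives is immaterial since
  \<open>FN_tilde m\<close> reduces to 0; later proofs use it only through
  \<open>reduce_cosets\<close>.\<close>

definition reduce :: "(nat \<Rightarrow> ('n::{finite,linorder}, 'v::finite) VN set) \<Rightarrow> ('n, 'v, 'v R_ring) tensor" where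
  "reduce c = (\<Sum>m|c m \<noteq> FN_tilde m. toRV (SOME F. F \<in> c m))"

lemma coset_eq_tilde_iff: "F +o FN_tilde m = FN_tilde m \<longleftrightarrow> F \<in> FN_tilde m"
  using coset_eq_iff[OF C_subspace_FN_tilde, of F m 0] by (simp only: diff_0_right set_zero_plus)

lemma F_star_carrier_eq:
  "(F_star_carrier :: (nat \<Rightarrow> ('n::{finite,linorder}, 'v::finite) VN set) set) = cosets ` families"
proof
  show "cosets ` families \<subseteq> (F_star_carrier :: (nat \<Rightarrow> ('n, 'v) VN set) set)"
  proof (rule image_subsetI)
    fix f :: "nat \<Rightarrow> ('n, 'v) VN" assume f: "f \<in> families"
    have "cosets f m = FN_tilde m" if "f m = 0" for m
      by (simp only: cosets_def that set_zero_plus)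
    then have "{m. cosets f m \<noteq> FN_tilde m} \<subseteq> {m. f m \<noteq> 0}"
      by blast
    with f show "cosets f \<in> F_star_carrier"
      unfolding F_star_carrier_def families_def
      by (auto simp: cosets_def FN_gr_def quotient_space_def intro: finite_subset)
  qed
  show "F_star_carrier \<subseteq> (cosets ` families :: (nat \<Rightarrow> ('n, 'v) VN set) set)"
  proof
    fix c :: "nat \<Rightarrow> ('n, 'v) VN set" assume c: "c \<in> F_star_carrier"
    \<comment> \<open>Representing the zero coset by 0 passes the finite support on to the
      representatives.\<close>
    have "\<exists>F. F \<in> FN_deg m \<and> c m = F +o FN_tilde m \<and> (c m = FN_tilde m \<longrightarrow> F = 0)" for m
    proof (cases "c m = FN_tilde m")
      case True
      then show ?thesis
        by (intro exI[of _ 0]) (simp only: set_zero_plus C_subspace_0[OF C_subspace_FN_deg] simp_thms)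
    next
      case False
      then show ?thesis
        using c unfolding F_star_carrier_def FN_gr_def quotient_space_def by blast
    qed
    then obtain f where f: "\<And>m. f m \<in> FN_deg m" "\<And>m. c m = f m +o FN_tilde m"
      "\<And>m. c m = FN_tilde m \<Longrightarrow> f m = 0"
      by metis
    have "{m. f m \<noteq> 0} \<subseteq> {m. c m \<noteq> FN_tilde m}"
      using f(3) by blast
    then have "f \<in> families"
      using f(1) c unfolding families_def F_star_carrier_def by (auto intro: finite_subset)
    moreover have "c = cosets f"
      unfolding cosets_def by (rule ext) (rule f(2))
    ultimately show "c \<in> cosets ` families" by blast
  qed
qed

lemma family_sum_superset: "finite A \<Longrightarrow> {m. f m \<noteq> 0} \<subseteq> A \<Longrightarrow> family_sum f = (\<Sum>m\<in>A. f m)"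
  unfolding family_sum_def by (rule sum.mono_neutral_left) auto

lemma reduce_cosets:
  assumes "f \<in> families"
  shows "reduce (cosets f) = toRV (family_sum f)"
proof -
  have some: "toRV (SOME F. F \<in> cosets f m) = toRV (f m)" for m
  proof -
    have "f m \<in> cosets f m"
      unfolding cosets_def set_minus_plus[symmetric] diff_self by (rule C_subspace_0[OF C_subspace_FN_tilde])
    then have "(SOME F. F \<in> cosets f m) \<in> f m +o FN_tilde m"
      unfolding cosets_def by (rule someI[where P = "\<lambda>F. F \<in> f m +o FN_tilde m"])
    then have "(SOME F. F \<in> cosets f m) - f m \<in> VJ"
      unfolding set_minus_plus[symmetric] FN_tilde_eq by blast
    then show ?thesis
      by (simp only: toRV_eq_iff)
  qed
  have "{m. cosets f m \<noteq> FN_tilde m} = {m. f m \<notin> FN_tilde m}"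
    by (simp only: cosets_def coset_eq_tilde_iff)
  then have "reduce (cosets f) = (\<Sum>m|f m \<notin> FN_tilde m. toRV (f m))"
    by (simp only: reduce_def some)
  \<comment> \<open>The extra terms are nonzero representatives of the zero coset, which reduce to
    0.\<close>
  also have "\<dots> = (\<Sum>m|f m \<noteq> 0. toRV (f m))"
  proof (rule sum.mono_neutral_left)
    show "finite {m. f m \<noteq> 0}" using assms by (simp add: families_def)
    show "{m. f m \<notin> FN_tilde m} \<subseteq> {m. f m \<noteq> 0}"
      using C_subspace_0[OF C_subspace_FN_tilde] by (metis (mono_tags, lifting) Collect_mono)
    show "\<forall>m\<in>{m. f m \<noteq> 0} - {m. f m \<notin> FN_tilde m}. toRV (f m) = 0"
      by (auto simp: FN_tilde_eq toRV_eq_0_iff)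
  qed
  finally show ?thesis
    by (simp only: family_sum_def toRV_sum)
qed

lemma family_sum_in_VS: "f \<in> families \<Longrightarrow> family_sum f \<in> VS"
  unfolding family_sum_def families_def using FN_deg_subset
  by (intro C_subspace_sum C_subspace_VS) blast

lemma vhcomp_family_sum:
  assumes "f \<in> families"
  shows "vhcomp m (family_sum f) = f m"
proof
  fix w
  \<comment> \<open>Adding \<open>m\<close> to the support lets the component be picked out even if
    \<open>f m\<close> is 0.\<close>
  let ?A = "insert m {k. f k \<noteq> 0}"
  have fin: "finite ?A" using assms by (simp add: families_def)
  have "homogeneous k (f k w)" for k
    using assms by (simp add: families_def FN_deg_def VN_deg_def)
  then have "hcomp m (f k w) = (if k = m then f k w else 0)" for k
    by (simp add: hcomp_homogeneous[of k])
  then show "vhcomp m (family_sum f) w = f m w"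
    using fin by (simp add: family_sum_superset[OF fin subset_insertI] vhcomp_def sum_fun_apply hcomp_sum sum.delta)
qed

lemma families_add:
  assumes "f \<in> families" "g \<in> families"
  shows "(\<lambda>m. f m + g m) \<in> families" "family_sum (\<lambda>m. f m + g m) = family_sum f + family_sum g"
proof -
  let ?A = "{m. f m \<noteq> 0} \<union> {m. g m \<noteq> 0}"
  have fin: "finite ?A" using assms by (simp add: families_def)
  have "f m \<noteq> 0 \<or> g m \<noteq> 0" if "f m + g m \<noteq> 0" for m
    using that by (rule contrapos_np) (simp only: de_Morgan_disj not_not add_0_left)
  then have sub: "{m. f m + g m \<noteq> 0} \<subseteq> ?A" "{m. f m \<noteq> 0} \<subseteq> ?A" "{m. g m \<noteq> 0} \<subseteq> ?A"
    by blast+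
  show "(\<lambda>m. f m + g m) \<in> families"
    using assms finite_subset[OF sub(1) fin] C_subspace_add[OF C_subspace_FN_deg]
    unfolding families_def by blast
  show "family_sum (\<lambda>m. f m + g m) = family_sum f + family_sum g"
    by (simp only: sub[THEN family_sum_superset[OF fin]] sum.distrib)
qed

lemma families_tscale:
  fixes f :: "nat \<Rightarrow> ('n::{finite,linorder}, 'v::finite) VN"
  assumes "f \<in> families"
  shows "(\<lambda>m. tscale Const c (f m)) \<in> families"
    "family_sum (\<lambda>m. tscale Const c (f m)) = tscale Const c (family_sum f)"
proof -
  have fin: "finite {m. f m \<noteq> 0}" using assms by (simp add: families_def)
  have "tscale Const c 0 = (0 :: ('n, 'v) VN)"
    by (rule ext) (simp add: tscale_def)
  then have sub: "{m. tscale Const c (f m) \<noteq> 0} \<subseteq> {m. f m \<noteq> 0}"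
    by (metis (mono_tags, lifting) Collect_mono)
  show "(\<lambda>m. tscale Const c (f m)) \<in> families"
    using assms finite_subset[OF sub fin] C_subspace_mult[OF C_subspace_FN_deg]
    unfolding families_def tscale_VN by blast
  show "family_sum (\<lambda>m. tscale Const c (f m)) = tscale Const c (family_sum f)"
    unfolding family_sum_superset[OF fin sub] family_sum_superset[OF fin order_refl]
    by (rule ext) (simp add: tscale_def sum_fun_apply sum_distrib_left)
qed

section \<open>Bijectivity onto the invariants and compatibility with degrees\<close>

lemma inj_on_reduce:
  "inj_on reduce (F_star_carrier :: (nat \<Rightarrow> ('n::{finite,linorder}, 'v::finite) VN set) set)"
  unfolding F_star_carrier_eq
proof (rule inj_onI, elim imageE, hypsubst)
  fix f g :: "nat \<Rightarrow> ('n, 'v) VN"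
  assume fg: "f \<in> families" "g \<in> families" and "reduce (cosets f) = reduce (cosets g)"
  then have "family_sum f - family_sum g \<in> VJ"
    by (simp only: reduce_cosets toRV_eq_iff)
  \<comment> \<open>The ideal is homogeneous, so the congruence of the sums holds in each degree
    separately.\<close>
  have "f m - g m \<in> FN_tilde m" for m
  proof -
    have "vhcomp m (family_sum f - family_sum g) = vhcomp m (family_sum f) - vhcomp m (family_sum g)"
      by (rule ext) (simp add: vhcomp_def hcomp_diff)
    then have "f m - g m \<in> VJ"
      using vhcomp_in_VJ[OF \<open>family_sum f - family_sum g \<in> VJ\<close>, of m] by (simp only: vhcomp_family_sum fg)
    moreover have "f m - g m \<in> FN_deg m"
      using fg by (intro C_subspace_diff C_subspace_FN_deg) (auto simp: families_def)
    ultimately show ?thesis by (simp add: FN_tilde_eq)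
  qed
  then show "cosets f = cosets g"
    by (intro ext) (simp only: cosets_def coset_eq_iff[OF C_subspace_FN_tilde])
qed

lemma reduce_in_invariants: "c \<in> F_star_carrier \<Longrightarrow> reduce c \<in> R_invariants_carrier"
  unfolding F_star_carrier_eq by (auto simp: reduce_cosets family_sum_in_VS toRV_in_invariants)

lemma reduce_surj:
  assumes "G \<in> R_invariants_carrier"
  shows "G \<in> reduce ` (F_star_carrier :: (nat \<Rightarrow> ('n::{finite,linorder}, 'v::finite) VN set) set)"
proof -
  have "to_R (rep_R r) = r" for r :: "'v R_ring"
    by (rule Quotient3_abs_rep[OF Quotient3_R_ring])
  then have G: "G = toRV (\<lambda>w. rep_R (G w))"
    by (simp add: toRV_def)
  obtain F where F: "F \<in> VS" "toRV F = G"
    using assms invariant_lift[of "\<lambda>w. rep_R (G w)"] G by metis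
  \<comment> \<open>A strict bound on the degrees in all coordinates; the inserted 0 keeps
    \<open>Max\<close> away from the empty set when \<open>F\<close> is 0.\<close>
  define M where "M = Suc (Max (insert 0 (\<Union>w. mdeg ` Poly_Mapping.keys (F w))))"
  have "mdeg \<mu> < M" if "\<mu> \<in> Poly_Mapping.keys (F w)" for \<mu> w
    unfolding M_def less_Suc_eq_le using that by (intro Max_ge) auto
  then have F_sum: "F = (\<Sum>m<M. vhcomp m F)"
    by (intro ext) (simp add: sum_fun_apply vhcomp_def sum_hcomp)
  have "\<exists>g. g \<in> FN_deg m \<and> vhcomp m F - g \<in> VJ" for m
    using VS_mod_J[OF vhcomp_in_VS[OF F(1)] vhcomp_in_VN_deg, of m] unfolding FN_mod_J_def by blast
  then obtain g where g: "\<And>m. g m \<in> FN_deg m" "\<And>m. vhcomp m F - g m \<in> VJ"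
    by metis
  \<comment> \<open>The elements \<open>g m\<close> are determined only modulo the ideal and need
    not vanish for large \<open>m\<close>; truncating ensures finite support.\<close>
  define f where "f m = (if m < M then g m else 0)" for m
  have sub: "{m. f m \<noteq> 0} \<subseteq> {..<M}"
    by (auto simp: f_def)
  have f: "f \<in> families"
    using g(1) finite_subset[OF sub] by (simp add: families_def f_def zero_in_FN_deg)
  have "toRV (family_sum f) = (\<Sum>m<M. toRV (g m))"
    by (simp add: family_sum_superset[OF _ sub] toRV_sum f_def)
  also have "\<dots> = (\<Sum>m<M. toRV (vhcomp m F))"
    using g(2) by (intro sum.cong) (simp_all only: toRV_eq_iff[symmetric])
  also have "\<dots> = toRV F"
    by (subst (2) F_sum) (simp only: toRV_sum)
  finally have "reduce (cosets f) = G"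
    using f F(2) by (simp add: reduce_cosets)
  then show ?thesis
    using f by (auto simp: F_star_carrier_eq)
qed

lemma reduce_degree:
  "reduce ` {c \<in> F_star_carrier. \<forall>k. k \<noteq> m \<longrightarrow> c k = FN_tilde k} =
    {G \<in> (R_invariants_carrier :: ('n::{finite,linorder}, 'v::finite, 'v R_ring) tensor set).
      \<forall>w. G w \<in> R_deg m}"
proof (intro equalityI subsetI)
  fix G :: "('n, 'v, 'v R_ring) tensor"
  assume "G \<in> reduce ` {c \<in> F_star_carrier. \<forall>k. k \<noteq> m \<longrightarrow> c k = FN_tilde k}"
  then obtain f where f: "f \<in> families" "G = reduce (cosets f)"
    "\<And>k. k \<noteq> m \<Longrightarrow> cosets f k = FN_tilde k"
    unfolding F_star_carrier_eq by blast
  let ?A = "insert m {k. f k \<noteq> 0}"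
  have fin: "finite ?A" using f(1) by (simp add: families_def)
  \<comment> \<open>Outside degree \<open>m\<close> only the cosets vanish, not the representatives
    themselves.\<close>
  have 0: "toRV (f k) = (if k = m then toRV (f m) else 0)" for k
  proof (cases "k = m")
    case False
    then have "f k \<in> FN_tilde k"
      using f(3) unfolding cosets_def coset_eq_tilde_iff by blast
    then have "toRV (f k) = 0"
      by (simp only: toRV_eq_0_iff FN_tilde_eq Int_iff)
    with False show ?thesis by simp
  qed simp
  have "G = (\<Sum>k\<in>?A. toRV (f k))"
    unfolding f(2) reduce_cosets[OF f(1)] family_sum_superset[OF fin subset_insertI] by (rule toRV_sum)
  also have "\<dots> = (\<Sum>k\<in>?A. if k = m then toRV (f m) else 0)"
    by (intro sum.cong refl 0)
  also have "\<dots> = toRV (f m)"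
    using fin by (simp only: sum.delta insertI1 if_True)
  finally have "G = toRV (f m)" .
  moreover have "f m \<in> VN_deg m"
    using f(1) by (simp add: families_def FN_deg_def)
  moreover have "G \<in> R_invariants_carrier"
    unfolding f(2) using f(1) by (intro reduce_in_invariants) (simp add: F_star_carrier_eq)
  ultimately show "G \<in> {G \<in> R_invariants_carrier. \<forall>w. G w \<in> R_deg m}"
    by (auto simp: R_deg_def toRV_def VN_deg_def)
next
  fix G :: "('n, 'v, 'v R_ring) tensor"
  assume G: "G \<in> {G \<in> R_invariants_carrier. \<forall>w. G w \<in> R_deg m}"
  then have "\<forall>w. \<exists>p. homogeneous m p \<and> G w = to_R p"
    by (auto simp: R_deg_def)
  then obtain F\<^sub>0 where F\<^sub>0: "\<And>w. homogeneous m (F\<^sub>0 w)" "\<And>w. G w = to_R (F\<^sub>0 w)"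
    by metis
  have "G = toRV F\<^sub>0" by (rule ext) (simp add: toRV_def F\<^sub>0)
  \<comment> \<open>A homogeneous lift of each coordinate stays homogeneous under averaging.\<close>
  with G obtain F where F: "F \<in> VS" "toRV F = G" "F\<^sub>0 \<in> VN_deg m \<Longrightarrow> F \<in> VN_deg m"
    using invariant_lift[of F\<^sub>0] by (metis (no_types, lifting) mem_Collect_eq)
  have "F \<in> VN_deg m" using F(3) F\<^sub>0(1) by (simp add: VN_deg_def)
  from VS_mod_J[OF F(1) this] obtain g where g: "g \<in> FN_deg m" "F - g \<in> VJ"
    unfolding FN_mod_J_def by blast
  define f where "f k = (if k = m then g else 0)" for k
  have sub: "{k. f k \<noteq> 0} \<subseteq> {m}"
    by (auto simp: f_def)
  have f: "f \<in> families"
    using g(1) finite_subset[OF sub] by (simp add: families_def f_def zero_in_FN_deg)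
  have "family_sum f = g"
    by (simp add: family_sum_superset[OF _ sub] f_def)
  with f g(2) F(2) have "G = reduce (cosets f)"
    by (simp only: reduce_cosets toRV_eq_iff[symmetric])
  moreover have "cosets f k = FN_tilde k" if "k \<noteq> m" for k
    using that by (simp only: cosets_def f_def if_False set_zero_plus)
  ultimately show "G \<in> reduce ` {c \<in> F_star_carrier. \<forall>k. k \<noteq> m \<longrightarrow> c k = FN_tilde k}"
    using f by (auto simp: F_star_carrier_eq)
qed

section \<open>Compatibility with addition, scalars and the Lie algebra\<close>

lemma reduce_add:
  assumes "c \<in> F_star_carrier" "d \<in> F_star_carrier"
  shows "reduce (\<lambda>m. c m + d m) = reduce c + reduce d"
proof -
  obtain f g where fg: "f \<in> families" "g \<in> families" "c = cosets f" "d = cosets g"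
    using assms unfolding F_star_carrier_eq by blast
  have "(\<lambda>m. c m + d m) = cosets (\<lambda>m. f m + g m)"
    unfolding fg cosets_def by (simp only: coset_plus_coset[OF C_subspace_FN_tilde])
  then show ?thesis
    by (simp only: fg reduce_cosets families_add toRV_add)
qed

lemma reduce_tscale:
  fixes c :: "nat \<Rightarrow> ('n::{finite,linorder}, 'v::finite) VN set"
  assumes "c \<in> F_star_carrier"
  shows "reduce (\<lambda>m. coset_map (tscale Const a) (FN_tilde m) (c m)) = tscale R_const a (reduce c)"
proof -
  obtain f where f: "f \<in> families" "c = cosets f"
    using assms unfolding F_star_carrier_eq by blast
  have add: "tscale Const a (F + G) = tscale Const a F + tscale Const a G" for F G :: "('n, 'v) VN"
    by (rule ext) (simp add: tscale_def distrib_left)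
  have "tscale Const a ` FN_tilde m \<subseteq> FN_tilde m" for m
    using C_subspace_mult[OF C_subspace_FN_tilde] unfolding tscale_VN by blast
  then have "(\<lambda>m. coset_map (tscale Const a) (FN_tilde m) (c m)) = cosets (\<lambda>m. tscale Const a (f m))"
    unfolding f cosets_def by (intro ext coset_map_coset C_subspace_FN_tilde add)
  then show ?thesis
    by (simp only: f reduce_cosets families_tscale toRV_tscale)
qed

lemma diag_act_add: "diag_act \<iota> x (F + G) = diag_act \<iota> x F + diag_act \<iota> x G"
  by (rule ext) (simp only: diag_act_def site_act_add plus_fun_apply sum.distrib)

lemma diag_act_0: "diag_act \<iota> x 0 = 0"
  by (rule ext) (simp add: diag_act_def site_act_def)

lemma diag_act_sum: "diag_act \<iota> x (sum f A) = (\<Sum>a\<in>A. diag_act \<iota> x (f a))"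
  by (induction A rule: infinite_finite_induct)
     (simp_all only: sum.infinite sum.empty sum.insert diag_act_add diag_act_0 not_False_eq_True)

lemma reduce_act:
  assumes "c \<in> F_star_carrier"
  shows "reduce (\<lambda>m. FN_gr_act m x (c m)) = diag_act R_const x (reduce c)"
proof -
  obtain f where f: "f \<in> families" "c = cosets f"
    using assms unfolding F_star_carrier_eq by blast
  \<comment> \<open>The last conjunct keeps the support of the chosen representatives inside that of
    \<open>f\<close>, hence finite.\<close>
  have "\<exists>G. G \<in> FN_deg m \<and> FN_gr_act m x (c m) = G +o FN_tilde m \<and>
      toRV G = diag_act R_const x (toRV (f m)) \<and> (f m = 0 \<longrightarrow> G = 0)" for m
  proof -
    have "f m \<in> FN_deg m" using f(1) by (simp add: families_def)
    then obtain G where G: "G \<in> FN_deg m" "FN_gr_act m x (c m) = G +o FN_tilde m"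
      "toRV G = diag_act R_const x (toRV (f m))"
      unfolding f(2) cosets_def by (rule FN_gr_act_coset)
    show ?thesis
    proof (cases "f m = 0")
      case True
      then have "toRV G = 0"
        using G(3) by (simp only: toRV_0 diag_act_0)
      then have "G \<in> VJ"
        by (simp only: toRV_eq_0_iff)
      with G(1) have "G \<in> FN_tilde m"
        by (simp only: FN_tilde_eq Int_iff)
      then have "G +o FN_tilde m = 0 +o FN_tilde m"
        by (simp only: set_zero_plus coset_eq_tilde_iff)
      then show ?thesis
        using True G(2)
        by (intro exI[of _ 0]) (simp only: C_subspace_0[OF C_subspace_FN_deg] toRV_0 diag_act_0 simp_thms)
    next
      case False
      with G show ?thesis by blast
    qed
  qed
  then obtain g where g: "\<And>m. g m \<in> FN_deg m" "\<And>m. FN_gr_act m x (c m) = g m +o FN_tilde m"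
      "\<And>m. toRV (g m) = diag_act R_const x (toRV (f m))" "\<And>m. f m = 0 \<Longrightarrow> g m = 0"
    by metis
  have fin: "finite {m. f m \<noteq> 0}" using f(1) by (simp add: families_def)
  have sub: "{m. g m \<noteq> 0} \<subseteq> {m. f m \<noteq> 0}" using g(4) by blast
  have "g \<in> families"
    unfolding families_def using g(1) finite_subset[OF sub fin] by blast
  have "reduce (\<lambda>m. FN_gr_act m x (c m)) = reduce (cosets g)"
    by (simp only: cosets_def g(2))
  also have "\<dots> = (\<Sum>m|f m \<noteq> 0. diag_act R_const x (toRV (f m)))"
    by (simp only: reduce_cosets[OF \<open>g \<in> families\<close>] family_sum_superset[OF fin sub] toRV_sum g(3))
  also have "\<dots> = diag_act R_const x (reduce c)"
    by (simp only: f(2) reduce_cosets[OF f(1)] family_sum_def toRV_sum diag_act_sum)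
  finally show ?thesis .
qed

theorem theorem4p3:
  assumes "CARD('n::{finite,linorder}) \<ge> 2"
  shows "graded_sl_isomorphic
           (F_star :: (nat \<Rightarrow> ('n, 'v::finite) VN set, 'n) graded_sl_module)
           (R_invariants :: (('n, 'v, 'v R_ring) tensor, 'n) graded_sl_module)"
  unfolding graded_sl_isomorphic_def
proof (intro exI[of _ reduce] conjI ballI allI)
  show "bij_betw reduce (gcarrier (F_star :: (nat \<Rightarrow> ('n, 'v) VN set, 'n) graded_sl_module))
      (gcarrier (R_invariants :: (('n, 'v, 'v R_ring) tensor, 'n) graded_sl_module))"
    using inj_on_reduce reduce_in_invariants reduce_surj
    by (auto simp: bij_betw_def F_star_def R_invariants_def)
qed (simp_all add: F_star_def R_invariants_def reduce_add reduce_tscale reduce_act reduce_degree)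

end
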